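(* Let $(A,X,\psi)$ be a cowreath in a strict monoidal category $\mathcal C$. Let $F:\mathcal C(\psi)_A^X\to\mathcal C_A$ be the forgetful functor and $G:\mathcal C_A\to\mathcal C(\psi)_A^X$, $G(N)=NX$, its right adjoint. If $\underline 1$ is a left $\otimes$-generator for $\mathcal C$, then there is a bijective correspondence between $\mathrm{Nat}(GF,\mathrm{Id}_{\mathcal C(\psi)_A^X})$ and the set of Casimir morphisms for $(X,\psi)$, that is, the subset of $\mathcal T_A^\#(XX,\underline 1)$ consisting of the morphisms $B:XX\to A$ satisfying $$mX\circ A\psi\circ AXB\circ\delta X=mX\circ ABX\circ\psi XX\circ X\delta .$$
   Context: Conventions: $\mathcal C$ is a strict monoidal category with unit object $\underline 1$; the tensor product is written by juxtaposition, and the identity morphism of $X$ is written $X$ (so $fA=f\otimes \mathrm{Id}_A$). $(A,m,\eta)$ is an algebra in $\mathcal C$; $\mathcal C_A$ is the category of right $A$-modules $(N,\mu:NA\to N)$. Left $\otimes$-generator: $P\in\mathcal C$ is a left $\otimes$-generator if for all $f,g:YZ\to W$ in $\mathcal C$: if $f\circ hZ=g\circ hZ$ for all $h:P\to Y$, then $f=g$. Transfer morphisms: $\mathcal T_A^\#$ has as objects the pairs $(X,\psi)$, $\psi:XA\to AX$ with $\psi\circ Xm=mX\circ A\psi\circ\psi A$ and $\psi\circ X\eta=\eta X$. A morphism $(X,\psi_X)\to(Y,\psi_Y)$ is $f:X\to AY$ in $\mathcal C$ with $mY\circ Af\circ\psi_X=mY\circ A\psi_Y\circ fA$; composition $g\bullet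 f=mZ\circ Ag\circ f$, identity $\eta X$; tensor product of objects $(XY,\psi_XY\circ X\psi_Y)$, of morphisms $f:X\to AX'$, $g:Y\to AY'$: $mX'Y'\circ A\psi_{X'}Y'\circ fg$; unit object $(\underline 1,A)$. In particular, $\mathcal T_A^\#(XX,\underline 1)$ consists of the $B:XX\to A$ in $\mathcal C$ with $m\circ BA=m\circ AB\circ\psi X\circ X\psi$. Cowreath: $(A,X,\psi)$ with $(X,\psi)$ a coalgebra in $\mathcal T_A^\#$; explicitly there are $\delta:X\to AXX$, $\epsilon:X\to A$ with $mXX\circ A\psi X\circ AX\psi\circ\delta A=mXX\circ A\delta\circ\psi$; $mXXX\circ A\delta X\circ\delta=mXXX\circ A\psi XX\circ AX\delta\circ\delta$; $m\circ A\epsilon\circ\psi=m\circ\epsilon A$; $mX\circ A\epsilon X\circ\delta=\eta X=mX\circ A\psi\circ AX\epsilon\circ\delta$. Entwined modules: objects of $\mathcal C(\psi)_A^X$ are $(M,\mu,\rho)$ with $(M,\mu)\in\mathcal C_A$, $\rho:M\to MX$, $\rho\circ\mu=\mu X\circ M\psi\circ\rho A$, $\rho X\circ\rho=\mu XX\circ M\delta\circ\rho$, $\mu\circ M\epsilon\circ\rho=M$. Morphisms are right $A$-linear $f$ with $fX\circ\rho=\rho\circ f$. The right adjoint $G$ of $F$: $G(N)=NX$ with action $\mu X\circ N\psi$ and coaction $\mu XX\circ N\delta$; $G(f)=fX$. *)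

theory Defs
  imports Main "HOL-Library.FuncSet"
begin

record ('o, 'a) category =
  Obj :: "'o set"
  Arr :: "'a set"
  Dom :: "'a \<Rightarrow> 'o"
  Cod :: "'a \<Rightarrow> 'o"
  Ide :: "'o \<Rightarrow> 'a"
  Comp :: "'a \<Rightarrow> 'a \<Rightarrow> 'a" (infixr "\<cdot>\<index>" 55)

definition Hom :: "('o, 'a, 'z) category_scheme \<Rightarrow> 'o \<Rightarrow> 'o \<Rightarrow> 'a set"
  where "Hom C X Y = {f \<in> Arr C. Dom C f = X \<and> Cod C f = Y}"

locale category =
  fixes C :: "('o, 'a, 'z) category_scheme" (structure)
  assumes Dom_closed: "f \<in> Arr C \<Longrightarrow> Dom C f \<in> Obj C"
    and Cod_closed: "f \<in> Arr C \<Longrightarrow> Cod C f \<in> Obj C"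
    and Ide_Hom: "X \<in> Obj C \<Longrightarrow> Ide C X \<in> Hom C X X"
    and Comp_Hom: "\<lbrakk>f \<in> Hom C X Y; g \<in> Hom C Y Z\<rbrakk> \<Longrightarrow> g \<cdot> f \<in> Hom C X Z"
    and Comp_Ide: "f \<in> Hom C X Y \<Longrightarrow> f \<cdot> Ide C X = f"
    and Ide_Comp: "f \<in> Hom C X Y \<Longrightarrow> Ide C Y \<cdot> f = f"
    and Comp_assoc:
      "\<lbrakk>f \<in> Hom C W X; g \<in> Hom C X Y; h \<in> Hom C Y Z\<rbrakk> \<Longrightarrow> (h \<cdot> g) \<cdot> f = h \<cdot> (g \<cdot> f)"

record ('o, 'a, 'p, 'b) func =
  on_obj :: "'o \<Rightarrow> 'p"
  on_arr :: "'a \<Rightarrow> 'b"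

definition id_func :: "('o, 'a, 'o, 'a) func"
  where "id_func = \<lparr>on_obj = \<lambda>X. X, on_arr = \<lambda>f. f\<rparr>"

definition comp_func ::
    "('p, 'b, 'q, 'c) func \<Rightarrow> ('o, 'a, 'p, 'b) func \<Rightarrow> ('o, 'a, 'q, 'c) func" (infixr "\<circ>\<^sub>F" 55)
  where "G \<circ>\<^sub>F F = \<lparr>on_obj = \<lambda>X. on_obj G (on_obj F X), on_arr = \<lambda>f. on_arr G (on_arr F f)\<rparr>"

text \<open>Families are extensional off the objects, so that each natural transformation is represented
  by exactly one function.\<close>

definition nat_trans :: "('o, 'a, 'y) category_scheme \<Rightarrow> ('p, 'b, 'z) category_scheme
    \<Rightarrow> ('o, 'a, 'p, 'b) func \<Rightarrow> ('o, 'a, 'p, 'b) func \<Rightarrow> ('o \<Rightarrow> 'b) set"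
  where "nat_trans C D F G =
    {\<alpha> \<in> (\<Pi>\<^sub>E X \<in> Obj C. Hom D (on_obj F X) (on_obj G X)).
      \<forall>f \<in> Arr C. \<alpha> (Cod C f) \<cdot>\<^bsub>D\<^esub> on_arr F f = on_arr G f \<cdot>\<^bsub>D\<^esub> \<alpha> (Dom C f)}"

record ('o, 'a) moncat = "('o, 'a) category" +
  tensor_obj :: "'o \<Rightarrow> 'o \<Rightarrow> 'o" (infixr "\<odot>\<index>" 75)
  tensor_arr :: "'a \<Rightarrow> 'a \<Rightarrow> 'a" (infixr "\<otimes>\<index>" 75)
  unit_obj :: 'o ("\<one>\<index>")

locale strict_monoidal_category = category C
  for C :: "('o, 'a) moncat" (structure) +
  assumes unit_closed: "\<one> \<in> Obj C"
    and tensor_obj_closed: "\<lbrakk>X \<in> Obj C; Y \<in> Obj C\<rbrakk> \<Longrightarrow> X \<odot> Y \<in> Obj C"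
    and tensor_obj_assoc: "\<lbrakk>X \<in> Obj C; Y \<in> Obj C; Z \<in> Obj C\<rbrakk> \<Longrightarrow> (X \<odot> Y) \<odot> Z = X \<odot> (Y \<odot> Z)"
    and unit_tensor_obj: "X \<in> Obj C \<Longrightarrow> \<one> \<odot> X = X"
    and tensor_obj_unit: "X \<in> Obj C \<Longrightarrow> X \<odot> \<one> = X"
    and tensor_arr_Hom:
      "\<lbrakk>f \<in> Hom C X X'; g \<in> Hom C Y Y'\<rbrakk> \<Longrightarrow> f \<otimes> g \<in> Hom C (X \<odot> Y) (X' \<odot> Y')"
    and tensor_arr_Ide: "\<lbrakk>X \<in> Obj C; Y \<in> Obj C\<rbrakk> \<Longrightarrow> Ide C X \<otimes> Ide C Y = Ide C (X \<odot> Y)"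
    and interchange:
      "\<lbrakk>f \<in> Hom C X X'; f' \<in> Hom C X' X''; g \<in> Hom C Y Y'; g' \<in> Hom C Y' Y''\<rbrakk>
       \<Longrightarrow> (f' \<cdot> f) \<otimes> (g' \<cdot> g) = (f' \<otimes> g') \<cdot> (f \<otimes> g)"
    and tensor_arr_assoc:
      "\<lbrakk>f \<in> Arr C; g \<in> Arr C; h \<in> Arr C\<rbrakk> \<Longrightarrow> (f \<otimes> g) \<otimes> h = f \<otimes> (g \<otimes> h)"
    and unit_tensor_arr: "f \<in> Arr C \<Longrightarrow> Ide C \<one> \<otimes> f = f"
    and tensor_arr_unit: "f \<in> Arr C \<Longrightarrow> f \<otimes> Ide C \<one> = f"

definition right_whisker :: "_ \<Rightarrow> 'a \<Rightarrow> 'o \<Rightarrow> 'a" (infixl "\<rhd>\<index>" 80)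
  where "f \<rhd> X = f \<otimes> Ide C X" for C :: "('o, 'a) moncat" (structure)

definition left_whisker :: "_ \<Rightarrow> 'o \<Rightarrow> 'a \<Rightarrow> 'a" (infixr "\<lhd>\<index>" 81)
  where "X \<lhd> f = Ide C X \<otimes> f" for C :: "('o, 'a) moncat" (structure)

definition left_tensor_generator :: "('o, 'a) moncat \<Rightarrow> 'o \<Rightarrow> bool"
  where "left_tensor_generator C P \<longleftrightarrow> P \<in> Obj C \<and>
    (\<forall>Y \<in> Obj C. \<forall>Z \<in> Obj C. \<forall>W \<in> Obj C. \<forall>f \<in> Hom C (Y \<odot> Z) W. \<forall>g \<in> Hom C (Y \<odot> Z) W.
      (\<forall>h \<in> Hom C P Y. f \<cdot> (h \<rhd> Z) = g \<cdot> (h \<rhd> Z)) \<longrightarrow> f = g)"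
  for C :: "('o, 'a) moncat" (structure)

locale algebra = strict_monoidal_category C
  for C :: "('o, 'a) moncat" (structure) +
  fixes A :: 'o and m :: 'a and \<eta> :: 'a
  assumes A_Obj: "A \<in> Obj C"
    and m_Hom: "m \<in> Hom C (A \<odot> A) A"
    and \<eta>_Hom: "\<eta> \<in> Hom C \<one> A"
    and m_assoc: "m \<cdot> (m \<rhd> A) = m \<cdot> (A \<lhd> m)"
    and unit_left: "m \<cdot> (\<eta> \<rhd> A) = Ide C A"
    and unit_right: "m \<cdot> (A \<lhd> \<eta>) = Ide C A"

text \<open>The ambient category is not required to be strict monoidal here: \<open>coalgebra\<close> is used in
  the category of transfer morphisms, so that no property of that category becomes a hypothesis.\<close>

definition coalgebra :: "('o, 'a) moncat \<Rightarrow> 'o \<Rightarrow> 'a \<Rightarrow> 'a \<Rightarrow> bool"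
  where "coalgebra C X \<delta> \<epsilon> \<longleftrightarrow>
    X \<in> Obj C \<and> \<delta> \<in> Hom C X (X \<odot> X) \<and> \<epsilon> \<in> Hom C X \<one> \<and>
    (\<delta> \<rhd> X) \<cdot> \<delta> = (X \<lhd> \<delta>) \<cdot> \<delta> \<and>
    (\<epsilon> \<rhd> X) \<cdot> \<delta> = Ide C X \<and>
    (X \<lhd> \<epsilon>) \<cdot> \<delta> = Ide C X"
  for C :: "('o, 'a) moncat" (structure)

text \<open>Arrows of a category of structured objects are triples (source, underlying arrow, target),
  since the underlying arrow does not determine the structures on its source and target.\<close>

definition arrows :: "'p set \<Rightarrow> ('p \<Rightarrow> 'p \<Rightarrow> 'a set) \<Rightarrow> ('p \<times> 'a \<times> 'p) set"
  where "arrows Ob H = {(P, f, Q). P \<in> Ob \<and> Q \<in> Ob \<and> f \<in> H P Q}"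

definition module_objs :: "('o, 'a) moncat \<Rightarrow> 'o \<Rightarrow> 'a \<Rightarrow> 'a \<Rightarrow> ('o \<times> 'a) set"
  where "module_objs C A m \<eta> = {(N, \<mu>). N \<in> Obj C \<and> \<mu> \<in> Hom C (N \<odot> A) N \<and>
    \<mu> \<cdot> (\<mu> \<rhd> A) = \<mu> \<cdot> (N \<lhd> m) \<and> \<mu> \<cdot> (N \<lhd> \<eta>) = Ide C N}"
  for C :: "('o, 'a) moncat" (structure)

definition module_homs :: "('o, 'a) moncat \<Rightarrow> 'o \<Rightarrow> 'o \<times> 'a \<Rightarrow> 'o \<times> 'a \<Rightarrow> 'a set"
  where "module_homs C A = (\<lambda>(N, \<mu>) (N', \<mu>').
    {f \<in> Hom C N N'. f \<cdot> \<mu> = \<mu>' \<cdot> (f \<rhd> A)})"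
  for C :: "('o, 'a) moncat" (structure)

definition module_cat ::
    "('o, 'a) moncat \<Rightarrow> 'o \<Rightarrow> 'a \<Rightarrow> 'a \<Rightarrow> ('o \<times> 'a, ('o \<times> 'a) \<times> 'a \<times> ('o \<times> 'a)) category"
  where "module_cat C A m \<eta> =
    \<lparr>Obj = module_objs C A m \<eta>,
     Arr = arrows (module_objs C A m \<eta>) (module_homs C A),
     Dom = (\<lambda>(P, f, Q). P),
     Cod = (\<lambda>(P, f, Q). Q),
     Ide = (\<lambda>(N, \<mu>). ((N, \<mu>), Ide C N, (N, \<mu>))),
     Comp = (\<lambda>(Q', g, R) (P, f, Q). (P, g \<cdot> f, R))\<rparr>"
  for C :: "('o, 'a) moncat" (structure)

definition transfer_objs :: "('o, 'a) moncat \<Rightarrow> 'o \<Rightarrow> 'a \<Rightarrow> 'a \<Rightarrow> ('o \<times> 'a) set"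
  where "transfer_objs C A m \<eta> = {(X, \<psi>). X \<in> Obj C \<and> \<psi> \<in> Hom C (X \<odot> A) (A \<odot> X) \<and>
    \<psi> \<cdot> (X \<lhd> m) = (m \<rhd> X) \<cdot> (A \<lhd> \<psi>) \<cdot> (\<psi> \<rhd> A) \<and> \<psi> \<cdot> (X \<lhd> \<eta>) = \<eta> \<rhd> X}"
  for C :: "('o, 'a) moncat" (structure)

definition transfer_homs :: "('o, 'a) moncat \<Rightarrow> 'o \<Rightarrow> 'a \<Rightarrow> 'o \<times> 'a \<Rightarrow> 'o \<times> 'a \<Rightarrow> 'a set"
  where "transfer_homs C A m = (\<lambda>(X, \<psi>) (Y, \<phi>).
    {f \<in> Hom C X (A \<odot> Y).
      (m \<rhd> Y) \<cdot> (A \<lhd> f) \<cdot> \<psi> = (m \<rhd> Y) \<cdot> (A \<lhd> \<phi>) \<cdot> (f \<rhd> A)})"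
  for C :: "('o, 'a) moncat" (structure)

definition transfer_tensor :: "('o, 'a) moncat \<Rightarrow> 'o \<times> 'a \<Rightarrow> 'o \<times> 'a \<Rightarrow> 'o \<times> 'a"
  where "transfer_tensor C = (\<lambda>(X, \<psi>) (Y, \<phi>). (X \<odot> Y, (\<psi> \<rhd> Y) \<cdot> (X \<lhd> \<phi>)))"
  for C :: "('o, 'a) moncat" (structure)

definition transfer_cat ::
    "('o, 'a) moncat \<Rightarrow> 'o \<Rightarrow> 'a \<Rightarrow> 'a \<Rightarrow> ('o \<times> 'a, ('o \<times> 'a) \<times> 'a \<times> ('o \<times> 'a)) moncat"
  where "transfer_cat C A m \<eta> =
    \<lparr>Obj = transfer_objs C A m \<eta>,
     Arr = arrows (transfer_objs C A m \<eta>) (transfer_homs C A m),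
     Dom = (\<lambda>(P, f, Q). P),
     Cod = (\<lambda>(P, f, Q). Q),
     Ide = (\<lambda>(X, \<psi>). ((X, \<psi>), \<eta> \<rhd> X, (X, \<psi>))),
     Comp = (\<lambda>(Q', g, (Z, \<theta>)) (P, f, Q). (P, (m \<rhd> Z) \<cdot> (A \<lhd> g) \<cdot> f, (Z, \<theta>))),
     tensor_obj = transfer_tensor C,
     tensor_arr = (\<lambda>(P, f, (X', \<psi>')) (Q, g, (Y', \<phi>')).
       (transfer_tensor C P Q,
        (m \<rhd> (X' \<odot> Y')) \<cdot> (A \<lhd> \<psi>' \<rhd> Y') \<cdot> (f \<otimes> g),
        transfer_tensor C (X', \<psi>') (Y', \<phi>'))),
     unit_obj = (\<one>, Ide C A)\<rparr>"
  for C :: "('o, 'a) moncat" (structure)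

definition cowreath ::
    "('o, 'a) moncat \<Rightarrow> 'o \<Rightarrow> 'a \<Rightarrow> 'a \<Rightarrow> 'o \<Rightarrow> 'a \<Rightarrow> 'a \<Rightarrow> 'a \<Rightarrow> bool"
  where "cowreath C A m \<eta> X \<psi> \<delta> \<epsilon> \<longleftrightarrow> algebra C A m \<eta> \<and>
    (let T = transfer_cat C A m \<eta> in
      coalgebra T (X, \<psi>) ((X, \<psi>), \<delta>, (X, \<psi>) \<odot>\<^bsub>T\<^esub> (X, \<psi>)) ((X, \<psi>), \<epsilon>, \<one>\<^bsub>T\<^esub>))"

definition casimir_morphisms ::
    "('o, 'a) moncat \<Rightarrow> 'o \<Rightarrow> 'a \<Rightarrow> 'a \<Rightarrow> 'o \<Rightarrow> 'a \<Rightarrow> 'a \<Rightarrow> 'a set"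
  where "casimir_morphisms C A m \<eta> X \<psi> \<delta> =
    {B \<in> transfer_homs C A m (transfer_tensor C (X, \<psi>) (X, \<psi>)) (\<one>, Ide C A).
      (m \<rhd> X) \<cdot> (A \<lhd> \<psi>) \<cdot> ((A \<odot> X) \<lhd> B) \<cdot> (\<delta> \<rhd> X)
        = (m \<rhd> X) \<cdot> (A \<lhd> B \<rhd> X) \<cdot> (\<psi> \<rhd> (X \<odot> X)) \<cdot> (X \<lhd> \<delta>)}"
  for C :: "('o, 'a) moncat" (structure)

definition entwined_objs ::
    "('o, 'a) moncat \<Rightarrow> 'o \<Rightarrow> 'a \<Rightarrow> 'a \<Rightarrow> 'o \<Rightarrow> 'a \<Rightarrow> 'a \<Rightarrow> 'a \<Rightarrow> ('o \<times> 'a \<times> 'a) set"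
  where "entwined_objs C A m \<eta> X \<psi> \<delta> \<epsilon> =
    {(M, \<mu>, \<rho>). (M, \<mu>) \<in> module_objs C A m \<eta> \<and> \<rho> \<in> Hom C M (M \<odot> X) \<and>
      \<rho> \<cdot> \<mu> = (\<mu> \<rhd> X) \<cdot> (M \<lhd> \<psi>) \<cdot> (\<rho> \<rhd> A) \<and>
      (\<rho> \<rhd> X) \<cdot> \<rho> = (\<mu> \<rhd> (X \<odot> X)) \<cdot> (M \<lhd> \<delta>) \<cdot> \<rho> \<and>
      \<mu> \<cdot> (M \<lhd> \<epsilon>) \<cdot> \<rho> = Ide C M}"
  for C :: "('o, 'a) moncat" (structure)

definition entwined_homs ::
    "('o, 'a) moncat \<Rightarrow> 'o \<Rightarrow> 'o \<Rightarrow> 'o \<times> 'a \<times> 'a \<Rightarrow> 'o \<times> 'a \<times> 'a \<Rightarrow> 'a set"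
  where "entwined_homs C A X = (\<lambda>(M, \<mu>, \<rho>) (M', \<mu>', \<rho>').
    {f \<in> module_homs C A (M, \<mu>) (M', \<mu>'). (f \<rhd> X) \<cdot> \<rho> = \<rho>' \<cdot> f})"
  for C :: "('o, 'a) moncat" (structure)

definition entwined_cat ::
    "('o, 'a) moncat \<Rightarrow> 'o \<Rightarrow> 'a \<Rightarrow> 'a \<Rightarrow> 'o \<Rightarrow> 'a \<Rightarrow> 'a \<Rightarrow> 'a
     \<Rightarrow> ('o \<times> 'a \<times> 'a, ('o \<times> 'a \<times> 'a) \<times> 'a \<times> ('o \<times> 'a \<times> 'a)) category"
  where "entwined_cat C A m \<eta> X \<psi> \<delta> \<epsilon> =
    \<lparr>Obj = entwined_objs C A m \<eta> X \<psi> \<delta> \<epsilon>,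
     Arr = arrows (entwined_objs C A m \<eta> X \<psi> \<delta> \<epsilon>) (entwined_homs C A X),
     Dom = (\<lambda>(P, f, Q). P),
     Cod = (\<lambda>(P, f, Q). Q),
     Ide = (\<lambda>(M, \<mu>, \<rho>). ((M, \<mu>, \<rho>), Ide C M, (M, \<mu>, \<rho>))),
     Comp = (\<lambda>(Q', g, R) (P, f, Q). (P, g \<cdot> f, R))\<rparr>"
  for C :: "('o, 'a) moncat" (structure)

definition forgetful :: "('o \<times> 'a \<times> 'a, ('o \<times> 'a \<times> 'a) \<times> 'a \<times> ('o \<times> 'a \<times> 'a),
    'o \<times> 'a, ('o \<times> 'a) \<times> 'a \<times> ('o \<times> 'a)) func"
  where "forgetful =
    \<lparr>on_obj = (\<lambda>(M, \<mu>, \<rho>). (M, \<mu>)),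
     on_arr = (\<lambda>((M, \<mu>, \<rho>), f, (M', \<mu>', \<rho>')). ((M, \<mu>), f, (M', \<mu>')))\<rparr>"

definition cofree_obj ::
    "('o, 'a) moncat \<Rightarrow> 'o \<Rightarrow> 'a \<Rightarrow> 'a \<Rightarrow> 'o \<times> 'a \<Rightarrow> 'o \<times> 'a \<times> 'a"
  where "cofree_obj C X \<psi> \<delta> = (\<lambda>(N, \<mu>).
    (N \<odot> X, (\<mu> \<rhd> X) \<cdot> (N \<lhd> \<psi>), (\<mu> \<rhd> (X \<odot> X)) \<cdot> (N \<lhd> \<delta>)))"
  for C :: "('o, 'a) moncat" (structure)

definition cofree :: "('o, 'a) moncat \<Rightarrow> 'o \<Rightarrow> 'a \<Rightarrow> 'a
    \<Rightarrow> ('o \<times> 'a, ('o \<times> 'a) \<times> 'a \<times> ('o \<times> 'a),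
       'o \<times> 'a \<times> 'a, ('o \<times> 'a \<times> 'a) \<times> 'a \<times> ('o \<times> 'a \<times> 'a)) func"
  where "cofree C X \<psi> \<delta> =
    \<lparr>on_obj = cofree_obj C X \<psi> \<delta>,
     on_arr = (\<lambda>(P, f, Q). (cofree_obj C X \<psi> \<delta> P, f \<rhd> X, cofree_obj C X \<psi> \<delta> Q))\<rparr>"
  for C :: "('o, 'a) moncat" (structure)

end

theory Submission
  imports Defs
begin

text \<open>A Casimir morphism \<open>B\<close> gives the transformation with component
  \<open>\<mu> \<circ> MB \<circ> \<rho>X\<close> at an entwined module \<open>(M, \<mu>, \<rho>)\<close>, and a transformation \<open>\<alpha>\<close> gives
  \<open>B = m \<circ> A\<epsilon> \<circ> \<beta>\<close> with \<open>\<beta> = \<alpha>\<^bsub>AX\<^esub> \<circ> \<eta>XX\<close>. Naturality along \<open>hA : A \<rightarrow> YA\<close> for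
  \<open>h : \<one> \<rightarrow> Y\<close> and the generator property force \<open>\<alpha>\<^bsub>YAX\<^esub> = Y\<alpha>\<^bsub>AX\<^esub>\<close>. As the action
  \<open>\<mu> : NA \<rightarrow> N\<close> is a module map from a free module, \<open>\<alpha>\<^bsub>NX\<^esub> = \<mu>X \<circ> N\<beta>\<close>; as the coaction
  \<open>\<rho> : M \<rightarrow> MX\<close> is an entwined map, the counit then recovers \<open>\<alpha>\<^bsub>M\<^esub>\<close> from \<open>B\<close>.
  Linearity of \<open>\<alpha>\<^bsub>AX\<^esub>\<close> makes \<open>\<beta>\<close>, hence \<open>B\<close>, a transfer morphism, and its colinearity
  identifies \<open>\<beta>\<close> with both sides of the Casimir condition.\<close>

section \<open>Calculus of whiskered arrows in a strict monoidal category\<close>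

context strict_monoidal_category
begin

lemma Hom_iff: "f \<in> Hom C X Y \<longleftrightarrow> f \<in> Arr C \<and> Dom C f = X \<and> Cod C f = Y"
  by (auto simp: Hom_def)

declare Dom_closed [simp] Cod_closed [simp] unit_closed [simp] tensor_obj_closed [simp]
  tensor_obj_assoc [simp] unit_tensor_obj [simp] tensor_obj_unit [simp]

lemma Ide_simps [simp]:
  assumes "X \<in> Obj C"
  shows "Ide C X \<in> Arr C" "Dom C (Ide C X) = X" "Cod C (Ide C X) = X"
  using Ide_Hom[OF assms] by (auto simp: Hom_iff)

lemma Comp_simps [simp]:
  assumes "f \<in> Arr C" "g \<in> Arr C" "Dom C g = Cod C f"
  shows "g \<cdot> f \<in> Arr C" "Dom C (g \<cdot> f) = Dom C f" "Cod C (g \<cdot> f) = Cod C g"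
  using Comp_Hom[of f "Dom C f" "Cod C f" g "Cod C g"] assms by (auto simp: Hom_iff)

lemma Comp_Ide_simps [simp]:
  assumes "f \<in> Arr C"
  shows "Dom C f = X \<Longrightarrow> f \<cdot> Ide C X = f" "Cod C f = X \<Longrightarrow> Ide C X \<cdot> f = f"
  using assms Comp_Ide Ide_Comp by (auto simp: Hom_iff)

lemma Comp_assoc_simp [simp]:
  assumes "f \<in> Arr C" "g \<in> Arr C" "h \<in> Arr C" "Dom C g = Cod C f" "Dom C h = Cod C g"
  shows "(h \<cdot> g) \<cdot> f = h \<cdot> (g \<cdot> f)"
  using assms Comp_assoc by (auto simp: Hom_iff)

lemma tensor_arr_simps [simp]:
  assumes "f \<in> Arr C" "g \<in> Arr C"
  shows "f \<otimes> g \<in> Arr C" "Dom C (f \<otimes> g) = Dom C f \<odot> Dom C g" "Cod C (f \<otimes> g) = Cod C f \<odot> Cod C g"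
  using tensor_arr_Hom[of f "Dom C f" "Cod C f" g "Dom C g" "Cod C g"] assms by (auto simp: Hom_iff)

lemma whisker_simps [simp]:
  assumes "f \<in> Arr C" "X \<in> Obj C"
  shows "f \<rhd> X \<in> Arr C" "Dom C (f \<rhd> X) = Dom C f \<odot> X" "Cod C (f \<rhd> X) = Cod C f \<odot> X"
    and "X \<lhd> f \<in> Arr C" "Dom C (X \<lhd> f) = X \<odot> Dom C f" "Cod C (X \<lhd> f) = X \<odot> Cod C f"
  using assms by (simp_all add: right_whisker_def left_whisker_def)

lemma interchange_simp:
  assumes "f \<in> Arr C" "f' \<in> Arr C" "g \<in> Arr C" "g' \<in> Arr C" "Dom C f' = Cod C f" "Dom C g' = Cod C g"
  shows "(f' \<otimes> g') \<cdot> (f \<otimes> g) = (f' \<cdot> f) \<otimes> (g' \<cdot> g)"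
  using assms interchange by (auto simp: Hom_iff)

lemma whisker_Ide [simp]:
  assumes "X \<in> Obj C" "Y \<in> Obj C"
  shows "Ide C X \<rhd> Y = Ide C (X \<odot> Y)" "X \<lhd> Ide C Y = Ide C (X \<odot> Y)"
  using assms by (simp_all add: right_whisker_def left_whisker_def tensor_arr_Ide)

lemma whisker_Comp [simp]:
  assumes "f \<in> Arr C" "g \<in> Arr C" "Dom C g = Cod C f" "X \<in> Obj C"
  shows "(g \<cdot> f) \<rhd> X = (g \<rhd> X) \<cdot> (f \<rhd> X)" "X \<lhd> (g \<cdot> f) = (X \<lhd> g) \<cdot> (X \<lhd> f)"
  using assms by (simp_all add: right_whisker_def left_whisker_def interchange_simp)

text \<open>Together with \<open>whisker_Comp\<close> these rules fix a normal form: whiskers sit on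
  single arrows, iterated whiskers merge, and a right whisker stands outside a left one.\<close>

lemma whisker_whisker [simp]:
  assumes "f \<in> Arr C" "X \<in> Obj C" "Y \<in> Obj C"
  shows "X \<lhd> (Y \<lhd> f) = (X \<odot> Y) \<lhd> f" "(f \<rhd> X) \<rhd> Y = f \<rhd> (X \<odot> Y)"
    and "X \<lhd> (f \<rhd> Y) = X \<lhd> f \<rhd> Y"
  using assms
  by (simp_all add: right_whisker_def left_whisker_def tensor_arr_assoc flip: tensor_arr_Ide)

lemma whisker_unit [simp]:
  assumes "f \<in> Arr C"
  shows "\<one> \<lhd> f = f" "f \<rhd> \<one> = f"
  using assms by (simp_all add: right_whisker_def left_whisker_def unit_tensor_arr tensor_arr_unit)

lemma tensor_arr_conv_whisker:
  assumes "f \<in> Arr C" "g \<in> Arr C"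
  shows "f \<otimes> g = (f \<rhd> Cod C g) \<cdot> (Dom C f \<lhd> g)"
  using assms by (simp add: right_whisker_def left_whisker_def interchange_simp)

text \<open>Interchange has no preferred direction, so it is no default rewrite rule and is supplied
  at chosen arrows.\<close>

lemma slide:
  assumes "f \<in> Arr C" "g \<in> Arr C"
  shows "(f \<rhd> Cod C g) \<cdot> (Dom C f \<lhd> g) = (Cod C f \<lhd> g) \<cdot> (f \<rhd> Dom C g)"
  using assms by (simp add: right_whisker_def left_whisker_def interchange_simp)

text \<open>Composites are kept nested to the right, which hides the redex of \<open>slide\<close>
  when another arrow is applied first; the tail \<open>h\<close> restores the match.\<close>

lemma slide_reassoc:
  assumes "f \<in> Arr C" "g \<in> Arr C" "h \<in> Arr C" "Cod C h = Dom C f \<odot> Dom C g"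
  shows "(f \<rhd> Cod C g) \<cdot> ((Dom C f \<lhd> g) \<cdot> h) = (Cod C f \<lhd> g) \<cdot> ((f \<rhd> Dom C g) \<cdot> h)"
  using assms slide[of f g] by (simp flip: Comp_assoc_simp)

end

section \<open>Transfer morphisms acting on modules\<close>

text \<open>Transfer morphisms \<open>f : U \<rightarrow> AV\<close> act on a right \<open>A\<close>-module \<open>N\<close> by
  \<open>NU \<rightarrow> NV\<close>, turning the composition \<open>\<bullet>\<close> into the ordinary one. The structure maps of
  \<open>NX\<close> are of this form, which reduces the diagram chases to identities between transfer morphisms.\<close>

definition module_action :: "('o, 'a) moncat \<Rightarrow> 'o \<times> 'a \<Rightarrow> 'o \<Rightarrow> 'a \<Rightarrow> 'a"
  where "module_action C = (\<lambda>(N, \<mu>) V f. (\<mu> \<rhd> V) \<cdot> (N \<lhd> f))"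
  for C :: "('o, 'a) moncat" (structure)

context algebra
begin

abbreviation "act \<equiv> module_action C"
abbreviation "modules \<equiv> module_objs C A m \<eta>"

lemma act_eq: "act (N, \<mu>) V f = (\<mu> \<rhd> V) \<cdot> (N \<lhd> f)"
  by (simp add: module_action_def)

lemma algebra_typing [simp]:
  "A \<in> Obj C" "m \<in> Arr C" "Dom C m = A \<odot> A" "Cod C m = A"
  "\<eta> \<in> Arr C" "Dom C \<eta> = \<one>" "Cod C \<eta> = A"
  using A_Obj m_Hom \<eta>_Hom by (auto simp: Hom_iff)

lemma regular_module [simp]: "(A, m) \<in> modules"
  using m_assoc unit_right by (simp add: module_objs_def Hom_iff)

lemma module_simps:
  assumes "(N, \<mu>) \<in> modules"
  shows "N \<in> Obj C" "\<mu> \<in> Arr C" "Dom C \<mu> = N \<odot> A" "Cod C \<mu> = N"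
    and "\<mu> \<cdot> (\<mu> \<rhd> A) = \<mu> \<cdot> (N \<lhd> m)" "\<mu> \<cdot> (N \<lhd> \<eta>) = Ide C N"
  using assms by (auto simp: module_objs_def Hom_iff)

lemma act_simps [simp]:
  assumes "(N, \<mu>) \<in> modules" "f \<in> Arr C" "Cod C f = A \<odot> V" "V \<in> Obj C"
  shows "act (N, \<mu>) V f \<in> Arr C" "Dom C (act (N, \<mu>) V f) = N \<odot> Dom C f" "Cod C (act (N, \<mu>) V f) = N \<odot> V"
  using assms module_simps[OF assms(1)] by (simp_all add: act_eq)

lemma whisker_act:
  assumes "(N, \<mu>) \<in> modules" "f \<in> Arr C" "Cod C f = A \<odot> V" "V \<in> Obj C" "k \<in> Arr C" "Dom C k = V"
  shows "(N \<lhd> k) \<cdot> act (N, \<mu>) V f = act (N, \<mu>) (Cod C k) ((A \<lhd> k) \<cdot> f)"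
  using assms module_simps[OF assms(1)] slide_reassoc[of \<mu> k "N \<lhd> f"] by (simp add: act_eq)

lemma act_right_whisker:
  assumes "(N, \<mu>) \<in> modules" "f \<in> Arr C" "Cod C f = A \<odot> V" "V \<in> Obj C" "Z \<in> Obj C"
  shows "act (N, \<mu>) V f \<rhd> Z = act (N, \<mu>) (V \<odot> Z) (f \<rhd> Z)"
  using assms module_simps[OF assms(1)] by (simp add: act_eq)

text \<open>Sliding \<open>g\<close> past the first action leaves two successive actions of
  \<open>A\<close>, and associativity of the module merges them into a multiplication by
  \<open>m\<close>. The arrow on the right is the composite of \<open>f\<close> and \<open>g\<close>
  as transfer morphisms.\<close>

lemma act_act:
  assumes "(N, \<mu>) \<in> modules" "f \<in> Arr C" "Cod C f = A \<odot> U" "U \<in> Obj C"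
    "g \<in> Arr C" "Dom C g = U" "Cod C g = A \<odot> V" "V \<in> Obj C"
  shows "act (N, \<mu>) V g \<cdot> act (N, \<mu>) U f = act (N, \<mu>) V ((m \<rhd> V) \<cdot> (A \<lhd> g) \<cdot> f)"
proof -
  note N = module_simps[OF assms(1)]
  have "act (N, \<mu>) V g \<cdot> act (N, \<mu>) U f = (\<mu> \<rhd> V) \<cdot> act (N, \<mu>) (A \<odot> V) ((A \<lhd> g) \<cdot> f)"
    using assms N whisker_act[of N \<mu> f U g] by (simp add: act_eq[of N \<mu> V])
  also have "\<dots> = ((\<mu> \<cdot> (\<mu> \<rhd> A)) \<rhd> V) \<cdot> (N \<lhd> ((A \<lhd> g) \<cdot> f))"
    using assms N(1-4) by (simp add: act_eq)
  also have "\<dots> = act (N, \<mu>) V ((m \<rhd> V) \<cdot> (A \<lhd> g) \<cdot> f)"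
    unfolding N(5) using assms N(1-4) by (simp add: act_eq)
  finally show ?thesis .
qed

lemma action_act:
  assumes "(N, \<mu>) \<in> modules" "f \<in> Arr C" "Cod C f = A \<odot> A"
  shows "\<mu> \<cdot> act (N, \<mu>) A f = act (N, \<mu>) \<one> (m \<cdot> f)"
proof -
  note N = module_simps(1-4)[OF assms(1)]
  \<comment> \<open>The action \<mu> is itself the action of \<open>Ide C A\<close>, seen as an
    arrow from \<open>A\<close> to \<open>A \<odot> \<one>\<close>, so \<open>act_act\<close>
    applies.\<close>
  have "\<mu> \<cdot> act (N, \<mu>) A f = act (N, \<mu>) \<one> (Ide C A) \<cdot> act (N, \<mu>) A f"
    using assms N by (simp add: act_eq)
  also have "\<dots> = act (N, \<mu>) \<one> (m \<cdot> f)"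
    using assms N by (simp add: act_act)
  finally show ?thesis .
qed

lemma act_unit:
  assumes "(N, \<mu>) \<in> modules" "V \<in> Obj C"
  shows "act (N, \<mu>) V (\<eta> \<rhd> V) = Ide C (N \<odot> V)"
  using arg_cong[OF module_simps(6)[OF assms(1)], of "\<lambda>z. z \<rhd> V"] assms module_simps(1-4)[OF assms(1)]
  by (simp add: act_eq)

text \<open>Precomposition with the unit undoes the action on the regular module. An equation
  between actions on \<open>A\<close> can therefore be cut down to the transfer morphisms
  themselves.\<close>

lemma regular_act_unit:
  assumes "f \<in> Arr C" "Cod C f = A \<odot> V" "V \<in> Obj C" "U = Dom C f"
  shows "act (A, m) V f \<cdot> (\<eta> \<rhd> U) = f"
  using assms arg_cong[OF unit_left, of "\<lambda>z. (z \<rhd> V) \<cdot> f"] slide[of \<eta> f]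
  by (simp add: act_eq)

text \<open>Interchange moves \<open>f\<close> past \<open>g\<close> and linearity moves it past the
  action, so a transfer morphism acts naturally in the module.\<close>

lemma act_module_hom:
  assumes "(N, \<mu>) \<in> modules" "(N', \<mu>') \<in> modules" "f \<in> module_homs C A (N, \<mu>) (N', \<mu>')"
    "g \<in> Arr C" "Cod C g = A \<odot> V" "V \<in> Obj C" "U = Dom C g"
  shows "act (N', \<mu>') V g \<cdot> (f \<rhd> U) = (f \<rhd> V) \<cdot> act (N, \<mu>) V g"
proof -
  have f: "f \<in> Arr C" "Dom C f = N" "Cod C f = N'" "f \<cdot> \<mu> = \<mu>' \<cdot> (f \<rhd> A)"
    using assms(3) by (auto simp: module_homs_def Hom_iff)
  note N = module_simps(1-4)[OF assms(1)] and N' = module_simps(1-4)[OF assms(2)]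
  have "act (N', \<mu>') V g \<cdot> (f \<rhd> U) = (\<mu>' \<rhd> V) \<cdot> (f \<rhd> (A \<odot> V)) \<cdot> (N \<lhd> g)"
    using assms N N' f(1-3) slide[of f g] by (simp add: act_eq)
  also have "\<dots> = ((f \<cdot> \<mu>) \<rhd> V) \<cdot> (N \<lhd> g)"
    unfolding f(4) using assms N N' f(1-3) by simp
  also have "\<dots> = (f \<rhd> V) \<cdot> act (N, \<mu>) V g"
    using assms N N' f(1-3) by (simp add: act_eq)
  finally show ?thesis .
qed

lemma free_module:
  assumes "Y \<in> Obj C"
  shows "(Y \<odot> A, Y \<lhd> m) \<in> modules"
  using assms arg_cong[OF m_assoc, of "\<lambda>z. Y \<lhd> z"] arg_cong[OF unit_right, of "\<lambda>z. Y \<lhd> z"]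
  by (simp add: module_objs_def Hom_iff)

text \<open>The unit passes \<phi> by the unit axiom of a transfer object and is then absorbed by
  \<open>m\<close>. Tensoring on the right with an identity transfer morphism is thus plain
  whiskering, which makes the coalgebra laws explicit.\<close>

lemma transfer_right_whisker:
  assumes "(Y, \<phi>) \<in> transfer_objs C A m \<eta>" "f \<in> Arr C" "Cod C f = A \<odot> Y" "Z \<in> Obj C"
  shows "(m \<rhd> (Y \<odot> Z)) \<cdot> (A \<lhd> \<phi> \<rhd> Z) \<cdot> (f \<otimes> (\<eta> \<rhd> Z)) = f \<rhd> Z"
proof -
  have Y: "Y \<in> Obj C" "\<phi> \<in> Arr C" "Dom C \<phi> = Y \<odot> A" "Cod C \<phi> = A \<odot> Y" "\<phi> \<cdot> (Y \<lhd> \<eta>) = \<eta> \<rhd> Y"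
    using assms(1) by (auto simp: transfer_objs_def Hom_iff)
  have "(m \<rhd> (Y \<odot> Z)) \<cdot> (A \<lhd> \<phi> \<rhd> Z) \<cdot> (f \<otimes> (\<eta> \<rhd> Z))
      = (m \<rhd> (Y \<odot> Z)) \<cdot> (A \<lhd> (\<phi> \<cdot> (Y \<lhd> \<eta>)) \<rhd> Z) \<cdot> (f \<rhd> Z)"
    using assms(2-) Y(1-4) slide[of f "\<eta> \<rhd> Z"] by (simp add: tensor_arr_conv_whisker)
  also have "\<dots> = f \<rhd> Z"
    unfolding Y(5) using assms(2-) Y(1-4) arg_cong[OF unit_right, of "\<lambda>z. (z \<rhd> (Y \<odot> Z)) \<cdot> (f \<rhd> Z)"]
    by simp
  finally show ?thesis .
qed

text \<open>Here the unit meets \<open>m\<close> as soon as \<theta> has slid past it; it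
  disappears, while \<theta> stays to carry \<open>A\<close> across \<open>Z\<close>.\<close>

lemma transfer_left_whisker:
  assumes "(Z, \<theta>) \<in> transfer_objs C A m \<eta>" "f \<in> Arr C" "Cod C f = A \<odot> Y" "Y \<in> Obj C"
  shows "(m \<rhd> (Z \<odot> Y)) \<cdot> (A \<lhd> \<theta> \<rhd> Y) \<cdot> ((\<eta> \<rhd> Z) \<otimes> f) = (\<theta> \<rhd> Y) \<cdot> (Z \<lhd> f)"
proof -
  have Z: "Z \<in> Obj C" "\<theta> \<in> Arr C" "Dom C \<theta> = Z \<odot> A" "Cod C \<theta> = A \<odot> Z"
    using assms(1) by (auto simp: transfer_objs_def Hom_iff)
  have "(m \<rhd> (Z \<odot> Y)) \<cdot> (A \<lhd> \<theta> \<rhd> Y) \<cdot> ((\<eta> \<rhd> Z) \<otimes> f)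
      = (m \<rhd> (Z \<odot> Y)) \<cdot> (\<eta> \<rhd> (A \<odot> Z \<odot> Y)) \<cdot> (\<theta> \<rhd> Y) \<cdot> (Z \<lhd> f)"
    using assms(2-) Z slide_reassoc[of \<eta> "\<theta> \<rhd> Y" "Z \<lhd> f"] by (simp add: tensor_arr_conv_whisker)
  also have "\<dots> = (\<theta> \<rhd> Y) \<cdot> (Z \<lhd> f)"
    using assms(2-) Z arg_cong[OF unit_left, of "\<lambda>z. (z \<rhd> (Z \<odot> Y)) \<cdot> (\<theta> \<rhd> Y) \<cdot> (Z \<lhd> f)"]
    by simp
  finally show ?thesis .
qed

end

section \<open>Cowreath axioms as equations in the base category\<close>

locale cowreath_structure = algebra C A m \<eta>
  for C :: "('o, 'a) moncat" (structure) and A m \<eta> +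
  fixes X :: 'o and \<psi> \<delta> \<epsilon> :: 'a
  assumes X_\<psi>: "(X, \<psi>) \<in> transfer_objs C A m \<eta>"
    and \<delta>_Hom: "\<delta> \<in> Hom C X (A \<odot> X \<odot> X)"
    and \<epsilon>_Hom: "\<epsilon> \<in> Hom C X A"
    and \<delta>_transfer: "(m \<rhd> (X \<odot> X)) \<cdot> (A \<lhd> \<delta>) \<cdot> \<psi>
      = (m \<rhd> (X \<odot> X)) \<cdot> (A \<lhd> \<psi> \<rhd> X) \<cdot> ((A \<odot> X) \<lhd> \<psi>) \<cdot> (\<delta> \<rhd> A)"
    and \<epsilon>_transfer: "m \<cdot> (A \<lhd> \<epsilon>) \<cdot> \<psi> = m \<cdot> (\<epsilon> \<rhd> A)"
    and coassoc: "(m \<rhd> (X \<odot> X \<odot> X)) \<cdot> (A \<lhd> \<delta> \<rhd> X) \<cdot> \<delta>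
      = (m \<rhd> (X \<odot> X \<odot> X)) \<cdot> (A \<lhd> \<psi> \<rhd> (X \<odot> X)) \<cdot> ((A \<odot> X) \<lhd> \<delta>) \<cdot> \<delta>"
    and counit_left: "(m \<rhd> X) \<cdot> (A \<lhd> \<epsilon> \<rhd> X) \<cdot> \<delta> = \<eta> \<rhd> X"
    and counit_right: "(m \<rhd> X) \<cdot> (A \<lhd> \<psi>) \<cdot> ((A \<odot> X) \<lhd> \<epsilon>) \<cdot> \<delta> = \<eta> \<rhd> X"

lemma cowreath_structureI:
  fixes C :: "('o, 'a) moncat" (structure)
  assumes "cowreath C A m \<eta> X \<psi> \<delta> \<epsilon>"
  shows "cowreath_structure C A m \<eta> X \<psi> \<delta> \<epsilon>"
proof -
  interpret algebra C A m \<eta>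
    using assms by (simp add: cowreath_def)
  let ?T = "transfer_cat C A m \<eta>"
  have coalg: "coalgebra ?T (X, \<psi>) ((X, \<psi>), \<delta>, transfer_tensor C (X, \<psi>) (X, \<psi>)) ((X, \<psi>), \<epsilon>, (\<one>, Ide C A))"
    using assms by (simp add: cowreath_def Let_def transfer_cat_def)
  \<comment> \<open>The memberships \<open>XX\<close> and \<open>unit\<close> need no computation:
    \<open>arrows\<close> admits a triple only if both of its ends are objects, and these are the
    targets of \<delta> and \<epsilon>.\<close>
  then have X_\<psi>: "(X, \<psi>) \<in> transfer_objs C A m \<eta>"
    and \<delta>': "\<delta> \<in> transfer_homs C A m (X, \<psi>) (transfer_tensor C (X, \<psi>) (X, \<psi>))"
    and \<epsilon>': "\<epsilon> \<in> transfer_homs C A m (X, \<psi>) (\<one>, Ide C A)"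
    and XX: "transfer_tensor C (X, \<psi>) (X, \<psi>) \<in> transfer_objs C A m \<eta>"
    and unit: "(\<one>, Ide C A) \<in> transfer_objs C A m \<eta>"
    by (auto simp: coalgebra_def Hom_def transfer_cat_def arrows_def)
  have X: "X \<in> Obj C" "\<psi> \<in> Arr C" "Dom C \<psi> = X \<odot> A" "Cod C \<psi> = A \<odot> X"
    using X_\<psi> by (auto simp: transfer_objs_def Hom_iff)
  have \<delta>: "\<delta> \<in> Arr C" "Dom C \<delta> = X" "Cod C \<delta> = A \<odot> X \<odot> X"
    and \<epsilon>: "\<epsilon> \<in> Arr C" "Dom C \<epsilon> = X" "Cod C \<epsilon> = A"
    using \<delta>' \<epsilon>' X by (auto simp: transfer_homs_def transfer_tensor_def Hom_iff)
  have T_simps: "\<And>Q' g Z \<theta> P f Q. (Q', g, (Z, \<theta>)) \<cdot>\<^bsub>?T\<^esub> (P, f, Q) = (P, (m \<rhd> Z) \<cdot> (A \<lhd> g) \<cdot> f, (Z, \<theta>))"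
    "\<And>P f Y \<phi> Q g Z \<theta>. (P, f, (Y, \<phi>)) \<otimes>\<^bsub>?T\<^esub> (Q, g, (Z, \<theta>)) = (transfer_tensor C P Q,
        (m \<rhd> (Y \<odot> Z)) \<cdot> (A \<lhd> \<phi> \<rhd> Z) \<cdot> (f \<otimes> g), transfer_tensor C (Y, \<phi>) (Z, \<theta>))"
    "Ide ?T (X, \<psi>) = ((X, \<psi>), \<eta> \<rhd> X, (X, \<psi>))"
    by (simp_all add: transfer_cat_def)
  have tt: "\<And>Y \<phi> Z \<theta>. transfer_tensor C (Y, \<phi>) (Z, \<theta>) = (Y \<odot> Z, (\<phi> \<rhd> Z) \<cdot> (Y \<lhd> \<theta>))"
    by (simp add: transfer_tensor_def)
  \<comment> \<open>Objects such as \<open>\<one> \<odot> X\<close> and identity structures are left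
    unreduced, since these equations must match the coalgebra laws before any
    simplification.\<close>
  have whiskers:
    "(m \<rhd> ((X \<odot> X) \<odot> X)) \<cdot> (A \<lhd> ((\<psi> \<rhd> X) \<cdot> (X \<lhd> \<psi>)) \<rhd> X) \<cdot> (\<delta> \<otimes> (\<eta> \<rhd> X)) = \<delta> \<rhd> X"
    "(m \<rhd> (X \<odot> (X \<odot> X))) \<cdot> (A \<lhd> \<psi> \<rhd> (X \<odot> X)) \<cdot> ((\<eta> \<rhd> X) \<otimes> \<delta>) = (\<psi> \<rhd> (X \<odot> X)) \<cdot> (X \<lhd> \<delta>)"
    "(m \<rhd> (\<one> \<odot> X)) \<cdot> (A \<lhd> Ide C A \<rhd> X) \<cdot> (\<epsilon> \<otimes> (\<eta> \<rhd> X)) = \<epsilon> \<rhd> X"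
    "(m \<rhd> (X \<odot> \<one>)) \<cdot> (A \<lhd> \<psi> \<rhd> \<one>) \<cdot> ((\<eta> \<rhd> X) \<otimes> \<epsilon>) = (\<psi> \<rhd> \<one>) \<cdot> (X \<lhd> \<epsilon>)"
    by (rule transfer_right_whisker[OF XX[unfolded tt]] transfer_left_whisker[OF X_\<psi>]
        transfer_right_whisker[OF unit]; use X \<delta> \<epsilon> in simp)+
  note raw = coalg[unfolded coalgebra_def right_whisker_def[of ?T] left_whisker_def[of ?T] tt T_simps
      prod.inject whiskers]
  show ?thesis
    using X_\<psi> \<delta> \<epsilon> X \<delta>' \<epsilon>' raw
    by unfold_locales (simp_all add: transfer_homs_def transfer_tensor_def Hom_iff)
qed

section \<open>Entwined modules and the cofree construction\<close>

context cowreath_structure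
begin

abbreviation "entwined \<equiv> entwined_objs C A m \<eta> X \<psi> \<delta> \<epsilon>"

lemma cowreath_simps [simp]:
  "X \<in> Obj C" "\<psi> \<in> Arr C" "Dom C \<psi> = X \<odot> A" "Cod C \<psi> = A \<odot> X"
  "\<delta> \<in> Arr C" "Dom C \<delta> = X" "Cod C \<delta> = A \<odot> X \<odot> X"
  "\<epsilon> \<in> Arr C" "Dom C \<epsilon> = X" "Cod C \<epsilon> = A"
  using X_\<psi> \<delta>_Hom \<epsilon>_Hom by (auto simp: transfer_objs_def Hom_iff)

lemma \<psi>_m: "\<psi> \<cdot> (X \<lhd> m) = (m \<rhd> X) \<cdot> (A \<lhd> \<psi>) \<cdot> (\<psi> \<rhd> A)"
  and \<psi>_\<eta>: "\<psi> \<cdot> (X \<lhd> \<eta>) = \<eta> \<rhd> X"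
  using X_\<psi> by (auto simp: transfer_objs_def)

lemma entwined_simps:
  assumes "(M, \<mu>, \<rho>) \<in> entwined"
  shows "(M, \<mu>) \<in> modules" "\<rho> \<in> Arr C" "Dom C \<rho> = M" "Cod C \<rho> = M \<odot> X"
    and "\<rho> \<cdot> \<mu> = act (M, \<mu>) X \<psi> \<cdot> (\<rho> \<rhd> A)"
    and "(\<rho> \<rhd> X) \<cdot> \<rho> = act (M, \<mu>) (X \<odot> X) \<delta> \<cdot> \<rho>"
    and "act (M, \<mu>) \<one> \<epsilon> \<cdot> \<rho> = Ide C M"
  using assms module_simps(1-4)[of M \<mu>] by (auto simp: entwined_objs_def Hom_iff act_eq)

lemma cofree_obj_eq: "cofree_obj C X \<psi> \<delta> (N, \<mu>) = (N \<odot> X, act (N, \<mu>) X \<psi>, act (N, \<mu>) (X \<odot> X) \<delta>)"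
  by (simp add: cofree_obj_def act_eq)

text \<open>The entwining condition carries \<rho> past the action at the cost of \<psi>. The
  resulting arrow \<open>(\<psi> \<rhd> V) \<cdot> (X \<lhd> f)\<close> is \<open>f\<close>
  whiskered by \<open>(X, \<psi>)\<close> on the left among transfer morphisms.\<close>

lemma coaction_act:
  assumes "(M, \<mu>, \<rho>) \<in> entwined" "f \<in> Arr C" "Cod C f = A \<odot> V" "V \<in> Obj C" "U = Dom C f"
  shows "(\<rho> \<rhd> V) \<cdot> act (M, \<mu>) V f = act (M, \<mu>) (X \<odot> V) ((\<psi> \<rhd> V) \<cdot> (X \<lhd> f)) \<cdot> (\<rho> \<rhd> U)"
proof -
  note E = entwined_simps(1-4)[OF assms(1)] and N = module_simps(1-4)[OF entwined_simps(1)[OF assms(1)]]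
  have "(\<rho> \<rhd> V) \<cdot> act (M, \<mu>) V f = ((\<rho> \<cdot> \<mu>) \<rhd> V) \<cdot> (M \<lhd> f)"
    using assms E N by (simp add: act_eq)
  also have "\<dots> = (act (M, \<mu>) X \<psi> \<rhd> V) \<cdot> (\<rho> \<rhd> (A \<odot> V)) \<cdot> (M \<lhd> f)"
    unfolding entwined_simps(5)[OF assms(1)] using assms E N by simp
  also have "\<dots> = act (M, \<mu>) (X \<odot> V) ((\<psi> \<rhd> V) \<cdot> (X \<lhd> f)) \<cdot> (\<rho> \<rhd> U)"
    using assms E N slide[of \<rho> f] by (simp add: act_eq)
  finally show ?thesis .
qed

lemma act_cofree:
  assumes "(N, \<mu>) \<in> modules" "f \<in> Arr C" "Cod C f = A \<odot> V" "V \<in> Obj C"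
  shows "act (N \<odot> X, act (N, \<mu>) X \<psi>) V f = act (N, \<mu>) (X \<odot> V) ((\<psi> \<rhd> V) \<cdot> (X \<lhd> f))"
  using assms module_simps(1-4)[OF assms(1)] by (simp add: act_eq)

text \<open>The two module laws are the images, under the action on \<open>N\<close>, of the
  compatibility of \<psi> with \<open>m\<close> and with \<eta>.\<close>

lemma cofree_module:
  assumes "(N, \<mu>) \<in> modules"
  shows "(N \<odot> X, act (N, \<mu>) X \<psi>) \<in> modules"
proof -
  note N = module_simps(1-4)[OF assms]
  let ?\<nu> = "act (N, \<mu>) X \<psi>"
  have "?\<nu> \<cdot> (?\<nu> \<rhd> A) = act (N, \<mu>) X ((m \<rhd> X) \<cdot> (A \<lhd> \<psi>) \<cdot> (\<psi> \<rhd> A))"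
    using assms N by (simp add: act_right_whisker act_act)
  also have "\<dots> = act (N, \<mu>) X (\<psi> \<cdot> (X \<lhd> m))"
    by (simp add: \<psi>_m)
  also have "\<dots> = ?\<nu> \<cdot> ((N \<odot> X) \<lhd> m)"
    using assms N by (simp add: act_eq)
  finally have assoc: "?\<nu> \<cdot> (?\<nu> \<rhd> A) = ?\<nu> \<cdot> ((N \<odot> X) \<lhd> m)" .
  have "?\<nu> \<cdot> ((N \<odot> X) \<lhd> \<eta>) = act (N, \<mu>) X (\<psi> \<cdot> (X \<lhd> \<eta>))"
    using assms N by (simp add: act_eq)
  also have "\<dots> = Ide C (N \<odot> X)"
    using assms by (simp add: \<psi>_\<eta> act_unit)
  finally show ?thesis
    using assms N assoc by (simp add: module_objs_def Hom_iff)
qed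

text \<open>The three axioms are the images under the action on \<open>N\<close> of
  \<open>\<delta>_transfer\<close>, \<open>coassoc\<close> and \<open>counit_right\<close>.\<close>

lemma cofree_entwined:
  assumes "(N, \<mu>) \<in> modules"
  shows "cofree_obj C X \<psi> \<delta> (N, \<mu>) \<in> entwined"
proof -
  note N = module_simps(1-4)[OF assms] and NX = cofree_module[OF assms]
  let ?\<nu> = "act (N, \<mu>) X \<psi>" and ?\<rho> = "act (N, \<mu>) (X \<odot> X) \<delta>"
  have "?\<rho> \<cdot> ?\<nu> = act (N, \<mu>) (X \<odot> X) ((m \<rhd> (X \<odot> X)) \<cdot> (A \<lhd> \<delta>) \<cdot> \<psi>)"
    using assms N by (simp add: act_act)
  also have "\<dots> = act (N, \<mu>) (X \<odot> X) ((\<psi> \<rhd> X) \<cdot> (X \<lhd> \<psi>)) \<cdot> act (N, \<mu>) (X \<odot> X \<odot> A) (\<delta> \<rhd> A)"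
    using assms N by (simp add: \<delta>_transfer act_act)
  also have "\<dots> = (?\<nu> \<rhd> X) \<cdot> ((N \<odot> X) \<lhd> \<psi>) \<cdot> (?\<rho> \<rhd> A)"
    using assms N by (simp add: act_eq)
  finally have 1: "?\<rho> \<cdot> ?\<nu> = (?\<nu> \<rhd> X) \<cdot> ((N \<odot> X) \<lhd> \<psi>) \<cdot> (?\<rho> \<rhd> A)" .
  have "(?\<rho> \<rhd> X) \<cdot> ?\<rho> = act (N, \<mu>) (X \<odot> X \<odot> X) ((m \<rhd> (X \<odot> X \<odot> X)) \<cdot> (A \<lhd> \<delta> \<rhd> X) \<cdot> \<delta>)"
    using assms N by (simp add: act_act act_right_whisker)
  also have "\<dots> = act (N \<odot> X, ?\<nu>) (X \<odot> X) \<delta> \<cdot> ?\<rho>"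
    using assms N NX by (simp add: coassoc act_act act_cofree)
  also have "\<dots> = (?\<nu> \<rhd> (X \<odot> X)) \<cdot> ((N \<odot> X) \<lhd> \<delta>) \<cdot> ?\<rho>"
    using assms N NX by (simp add: act_eq)
  finally have 2: "(?\<rho> \<rhd> X) \<cdot> ?\<rho> = (?\<nu> \<rhd> (X \<odot> X)) \<cdot> ((N \<odot> X) \<lhd> \<delta>) \<cdot> ?\<rho>" .
  have "?\<nu> \<cdot> ((N \<odot> X) \<lhd> \<epsilon>) \<cdot> ?\<rho> = act (N \<odot> X, ?\<nu>) \<one> \<epsilon> \<cdot> ?\<rho>"
    using assms N NX by (simp add: act_eq)
  also have "\<dots> = Ide C (N \<odot> X)"
    using assms N NX by (simp add: counit_right act_act act_cofree act_unit)
  finally have 3: "?\<nu> \<cdot> ((N \<odot> X) \<lhd> \<epsilon>) \<cdot> ?\<rho> = Ide C (N \<odot> X)" .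
  show ?thesis
    using assms N NX 1 2 3 by (simp add: cofree_obj_eq entwined_objs_def Hom_iff)
qed

lemma cofree_hom:
  assumes "(N, \<mu>) \<in> modules" "(N', \<mu>') \<in> modules" "f \<in> module_homs C A (N, \<mu>) (N', \<mu>')"
  shows "f \<rhd> X \<in> entwined_homs C A X (cofree_obj C X \<psi> \<delta> (N, \<mu>)) (cofree_obj C X \<psi> \<delta> (N', \<mu>'))"
proof -
  have f: "f \<in> Arr C" "Dom C f = N" "Cod C f = N'"
    using assms(3) by (auto simp: module_homs_def Hom_iff)
  show ?thesis
    using assms f module_simps(1)[OF assms(1)] module_simps(1)[OF assms(2)]
    by (simp add: entwined_homs_def module_homs_def cofree_obj_eq Hom_iff act_module_hom[OF assms])
qed

text \<open>This is the unit of the adjunction between the forgetful and the cofree functor: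
  linearity is the entwining condition, colinearity the coassociativity of \<rho>.\<close>

lemma coaction_hom:
  assumes "(M, \<mu>, \<rho>) \<in> entwined"
  shows "\<rho> \<in> entwined_homs C A X (M, \<mu>, \<rho>) (cofree_obj C X \<psi> \<delta> (M, \<mu>))"
  using entwined_simps[OF assms]
  by (simp add: entwined_homs_def module_homs_def cofree_obj_eq Hom_iff)

section \<open>Transformation components defined by Casimir morphisms\<close>

lemma casimir_simps:
  assumes "B \<in> casimir_morphisms C A m \<eta> X \<psi> \<delta>"
  shows "B \<in> Arr C" "Dom C B = X \<odot> X" "Cod C B = A"
    and "m \<cdot> (A \<lhd> B) \<cdot> (\<psi> \<rhd> X) \<cdot> (X \<lhd> \<psi>) = m \<cdot> (B \<rhd> A)"
    and "(m \<rhd> X) \<cdot> (A \<lhd> \<psi>) \<cdot> ((A \<odot> X) \<lhd> B) \<cdot> (\<delta> \<rhd> X)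
        = (m \<rhd> X) \<cdot> (A \<lhd> B \<rhd> X) \<cdot> (\<psi> \<rhd> (X \<odot> X)) \<cdot> (X \<lhd> \<delta>)"
  using assms by (auto simp: casimir_morphisms_def transfer_homs_def transfer_tensor_def Hom_iff)

text \<open>Linearity comes from the transfer condition on \<open>B\<close>, colinearity from the
  Casimir condition.\<close>

lemma casimir_component_hom:
  assumes "B \<in> casimir_morphisms C A m \<eta> X \<psi> \<delta>" "(M, \<mu>, \<rho>) \<in> entwined"
  shows "act (M, \<mu>) \<one> B \<cdot> (\<rho> \<rhd> X) \<in> entwined_homs C A X (cofree_obj C X \<psi> \<delta> (M, \<mu>)) (M, \<mu>, \<rho>)"
proof -
  note B = casimir_simps[OF assms(1)] and E = entwined_simps(1-4)[OF assms(2)]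
  note M = module_simps(1-4)[OF E(1)]
  let ?\<nu> = "act (M, \<mu>) X \<psi>" and ?\<alpha> = "act (M, \<mu>) \<one> B \<cdot> (\<rho> \<rhd> X)"
  have "?\<alpha> \<cdot> ?\<nu> = act (M, \<mu>) \<one> B \<cdot> act (M, \<mu>) (X \<odot> X) ((\<psi> \<rhd> X) \<cdot> (X \<lhd> \<psi>)) \<cdot> (\<rho> \<rhd> (X \<odot> A))"
    using B(1-3) E M coaction_act[OF assms(2), of \<psi> X "X \<odot> A"] by simp
  also have "\<dots> = (act (M, \<mu>) \<one> B \<cdot> act (M, \<mu>) (X \<odot> X) ((\<psi> \<rhd> X) \<cdot> (X \<lhd> \<psi>))) \<cdot> (\<rho> \<rhd> (X \<odot> A))"
    using B(1-3) E M by simp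
  also have "act (M, \<mu>) \<one> B \<cdot> act (M, \<mu>) (X \<odot> X) ((\<psi> \<rhd> X) \<cdot> (X \<lhd> \<psi>)) = act (M, \<mu>) \<one> (m \<cdot> (B \<rhd> A))"
    using B(1-3) E M by (simp add: act_act flip: B(4))
  also have "\<dots> = \<mu> \<cdot> act (M, \<mu>) A (B \<rhd> A)"
    using B(1-3) E M by (simp add: action_act)
  also have "(\<mu> \<cdot> act (M, \<mu>) A (B \<rhd> A)) \<cdot> (\<rho> \<rhd> (X \<odot> A)) = \<mu> \<cdot> (?\<alpha> \<rhd> A)"
    using B(1-3) E M by (simp add: act_right_whisker)
  finally have 1: "?\<alpha> \<cdot> ?\<nu> = \<mu> \<cdot> (?\<alpha> \<rhd> A)" .
  have coact_\<delta>: "(\<rho> \<rhd> (X \<odot> X)) \<cdot> act (M, \<mu>) (X \<odot> X) \<delta>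
      = act (M, \<mu>) (X \<odot> X \<odot> X) ((\<psi> \<rhd> (X \<odot> X)) \<cdot> (X \<lhd> \<delta>)) \<cdot> (\<rho> \<rhd> X)"
    and coact_B: "\<rho> \<cdot> act (M, \<mu>) \<one> B = act (M, \<mu>) X (\<psi> \<cdot> (X \<lhd> B)) \<cdot> (\<rho> \<rhd> (X \<odot> X))"
    using coaction_act[OF assms(2) cowreath_simps(5,7)] coaction_act[OF assms(2) B(1), of \<one>] B(1-3) E M
    by simp_all
  have "(?\<alpha> \<rhd> X) \<cdot> act (M, \<mu>) (X \<odot> X) \<delta>
      = act (M, \<mu>) X (B \<rhd> X) \<cdot> act (M, \<mu>) (X \<odot> X \<odot> X) ((\<psi> \<rhd> (X \<odot> X)) \<cdot> (X \<lhd> \<delta>)) \<cdot> (\<rho> \<rhd> X)"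
    using coact_\<delta> B(1-3) E M by (simp add: act_right_whisker)
  also have "\<dots> = (act (M, \<mu>) X (B \<rhd> X) \<cdot> act (M, \<mu>) (X \<odot> X \<odot> X) ((\<psi> \<rhd> (X \<odot> X)) \<cdot> (X \<lhd> \<delta>))) \<cdot> (\<rho> \<rhd> X)"
    using B(1-3) E M by simp
  \<comment> \<open>The Casimir condition moves \<delta> to the first factor \<open>X\<close>, the
    one produced by \<rho>. There coassociativity of \<rho> turns it into a second coaction.\<close>
  also have "\<dots> = act (M, \<mu>) X ((m \<rhd> X) \<cdot> (A \<lhd> \<psi>) \<cdot> ((A \<odot> X) \<lhd> B) \<cdot> (\<delta> \<rhd> X)) \<cdot> (\<rho> \<rhd> X)"
    using B(1-3) E M by (simp add: act_act B(5))
  also have "\<dots> = act (M, \<mu>) X (\<psi> \<cdot> (X \<lhd> B)) \<cdot> ((act (M, \<mu>) (X \<odot> X) \<delta> \<cdot> \<rho>) \<rhd> X)"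
    using B(1-3) E M by (simp add: act_right_whisker act_act flip: Comp_assoc_simp)
  also have "\<dots> = act (M, \<mu>) X (\<psi> \<cdot> (X \<lhd> B)) \<cdot> (\<rho> \<rhd> (X \<odot> X)) \<cdot> (\<rho> \<rhd> X)"
    using B(1-3) E M by (simp flip: entwined_simps(6)[OF assms(2)])
  also have "\<dots> = (act (M, \<mu>) X (\<psi> \<cdot> (X \<lhd> B)) \<cdot> (\<rho> \<rhd> (X \<odot> X))) \<cdot> (\<rho> \<rhd> X)"
    using B(1-3) E M by simp
  also have "\<dots> = \<rho> \<cdot> ?\<alpha>"
    unfolding coact_B[symmetric] using B(1-3) E M by simp
  finally have 2: "(?\<alpha> \<rhd> X) \<cdot> act (M, \<mu>) (X \<odot> X) \<delta> = \<rho> \<cdot> ?\<alpha>" .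
  show ?thesis
    using B(1-3) E M 1 2 by (simp add: entwined_homs_def module_homs_def cofree_obj_eq Hom_iff)
qed

lemma casimir_component_natural:
  assumes "B \<in> casimir_morphisms C A m \<eta> X \<psi> \<delta>" "(M, \<mu>, \<rho>) \<in> entwined" "(M', \<mu>', \<rho>') \<in> entwined"
    "f \<in> entwined_homs C A X (M, \<mu>, \<rho>) (M', \<mu>', \<rho>')"
  shows "(act (M', \<mu>') \<one> B \<cdot> (\<rho>' \<rhd> X)) \<cdot> (f \<rhd> X) = f \<cdot> (act (M, \<mu>) \<one> B \<cdot> (\<rho> \<rhd> X))"
proof -
  note B = casimir_simps(1-3)[OF assms(1)] and E = entwined_simps(1-4)[OF assms(2)] and E' = entwined_simps(1-4)[OF assms(3)]
  note M = module_simps(1-4)[OF E(1)] module_simps(1-4)[OF E'(1)]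
  have fm: "f \<in> module_homs C A (M, \<mu>) (M', \<mu>')" and fr: "(f \<rhd> X) \<cdot> \<rho> = \<rho>' \<cdot> f"
    using assms(4) by (auto simp: entwined_homs_def)
  then have f: "f \<in> Arr C" "Dom C f = M" "Cod C f = M'"
    by (auto simp: module_homs_def Hom_iff)
  have "(act (M', \<mu>') \<one> B \<cdot> (\<rho>' \<rhd> X)) \<cdot> (f \<rhd> X) = act (M', \<mu>') \<one> B \<cdot> ((\<rho>' \<cdot> f) \<rhd> X)"
    using B E E' M f by simp
  also have "\<dots> = (act (M', \<mu>') \<one> B \<cdot> (f \<rhd> (X \<odot> X))) \<cdot> (\<rho> \<rhd> X)"
    using B E E' M f by (simp flip: fr)
  also have "\<dots> = f \<cdot> (act (M, \<mu>) \<one> B \<cdot> (\<rho> \<rhd> X))"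
    using B E E' M f act_module_hom[OF E(1) E'(1) fm, of B \<one> "X \<odot> X"] by simp
  finally show ?thesis .
qed

text \<open>The right-hand side is the left side of the Casimir condition, written as an action.
  That side is thus the component at \<open>A \<odot> X\<close> restricted along the unit.\<close>

lemma cofree_component:
  assumes "B \<in> Arr C" "Dom C B = X \<odot> X" "Cod C B = A"
  shows "act (A \<odot> X, act (A, m) X \<psi>) \<one> B \<cdot> (act (A, m) (X \<odot> X) \<delta> \<rhd> X) \<cdot> (\<eta> \<rhd> (X \<odot> X))
    = act (A, m) X (\<psi> \<cdot> (X \<lhd> B)) \<cdot> (\<delta> \<rhd> X)"
proof -
  have "act (A, m) (X \<odot> X \<odot> X) (\<delta> \<rhd> X) \<cdot> (\<eta> \<rhd> (X \<odot> X)) = \<delta> \<rhd> X"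
    by (rule regular_act_unit) simp_all
  then show ?thesis
    using assms by (simp add: act_cofree act_right_whisker)
qed

text \<open>The arrow \<open>m \<cdot> (A \<lhd> \<epsilon>)\<close> is the counit of the adjunction
  at \<open>A\<close>.\<close>

definition casimir_of :: "('o \<times> 'a \<times> 'a \<Rightarrow> 'a) \<Rightarrow> 'a"
  where "casimir_of c = m \<cdot> (A \<lhd> \<epsilon>) \<cdot> c (cofree_obj C X \<psi> \<delta> (A, m)) \<cdot> (\<eta> \<rhd> (X \<odot> X))"

definition casimir_component :: "'a \<Rightarrow> 'o \<times> 'a \<times> 'a \<Rightarrow> 'a"
  where "casimir_component B = (\<lambda>(M, \<mu>, \<rho>). act (M, \<mu>) \<one> B \<cdot> (\<rho> \<rhd> X))"

text \<open>The transfer condition on \<epsilon> brings it to the first factor \<open>X\<close>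
  produced by \<delta>. There the left counit law collapses \<delta> to the unit, and the unit
  cancels against the action on \<open>A\<close>.\<close>

lemma casimir_of_component:
  assumes "B \<in> casimir_morphisms C A m \<eta> X \<psi> \<delta>"
  shows "casimir_of (casimir_component B) = B"
proof -
  note B = casimir_simps(1-3)[OF assms]
  have cu: "act (A, m) X (\<epsilon> \<rhd> X) \<cdot> \<delta> = \<eta> \<rhd> X"
    using counit_left by (simp add: act_eq)
  have "casimir_of (casimir_component B) = act (A, m) \<one> \<epsilon> \<cdot> act (A, m) X (\<psi> \<cdot> (X \<lhd> B)) \<cdot> (\<delta> \<rhd> X)"
    using B cofree_module[OF regular_module]
    by (simp add: casimir_of_def casimir_component_def cofree_obj_eq cofree_component act_eq[of A m \<one>])
  also have "\<dots> = (act (A, m) \<one> \<epsilon> \<cdot> act (A, m) X (\<psi> \<cdot> (X \<lhd> B))) \<cdot> (\<delta> \<rhd> X)"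
    using B by simp
  also have "act (A, m) \<one> \<epsilon> \<cdot> act (A, m) X (\<psi> \<cdot> (X \<lhd> B)) = act (A, m) \<one> ((m \<cdot> (A \<lhd> \<epsilon>) \<cdot> \<psi>) \<cdot> (X \<lhd> B))"
    using B by (simp add: act_act)
  also have "\<dots> = act (A, m) \<one> (m \<cdot> (A \<lhd> B) \<cdot> (\<epsilon> \<rhd> (X \<odot> X)))"
    unfolding \<epsilon>_transfer using B slide[of \<epsilon> B] by simp
  also have "\<dots> = m \<cdot> act (A, m) A ((A \<lhd> B) \<cdot> (\<epsilon> \<rhd> (X \<odot> X)))"
    using B by (simp add: action_act)
  also have "\<dots> = m \<cdot> (A \<lhd> B) \<cdot> (act (A, m) X (\<epsilon> \<rhd> X) \<rhd> X)"
    using B by (simp add: whisker_act act_right_whisker)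
  also have "(m \<cdot> (A \<lhd> B) \<cdot> (act (A, m) X (\<epsilon> \<rhd> X) \<rhd> X)) \<cdot> (\<delta> \<rhd> X)
      = m \<cdot> (A \<lhd> B) \<cdot> ((act (A, m) X (\<epsilon> \<rhd> X) \<cdot> \<delta>) \<rhd> X)"
    using B by simp
  also have "\<dots> = act (A, m) \<one> B \<cdot> (\<eta> \<rhd> (X \<odot> X))"
    unfolding cu using B by (simp add: act_eq)
  also have "\<dots> = B"
    by (rule regular_act_unit) (use B in simp_all)
  finally show ?thesis .
qed

end

section \<open>Reconstruction of a transformation from its Casimir morphism\<close>

text \<open>\<open>c\<close> gives the underlying morphisms of a transformation \<open>GF \<rightarrow> Id\<close>; only its values on entwined
  modules matter.\<close>

locale cofree_transformation = cowreath_structure C A m \<eta> X \<psi> \<delta> \<epsilon>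
  for C :: "('o, 'a) moncat" (structure) and A m \<eta> X \<psi> \<delta> \<epsilon> +
  fixes c :: "'o \<times> 'a \<times> 'a \<Rightarrow> 'a"
  assumes component_hom: "(M, \<mu>, \<rho>) \<in> entwined
      \<Longrightarrow> c (M, \<mu>, \<rho>) \<in> entwined_homs C A X (cofree_obj C X \<psi> \<delta> (M, \<mu>)) (M, \<mu>, \<rho>)"
    and natural: "\<lbrakk>P \<in> entwined; Q \<in> entwined; f \<in> entwined_homs C A X P Q\<rbrakk>
      \<Longrightarrow> c Q \<cdot> (f \<rhd> X) = f \<cdot> c P"
    and generator: "left_tensor_generator C \<one>"
begin

abbreviation "cofree_component_at N \<mu> \<equiv> c (cofree_obj C X \<psi> \<delta> (N, \<mu>))"

lemma component_simps:
  assumes "(M, \<mu>, \<rho>) \<in> entwined"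
  shows "c (M, \<mu>, \<rho>) \<in> Arr C" "Dom C (c (M, \<mu>, \<rho>)) = M \<odot> X" "Cod C (c (M, \<mu>, \<rho>)) = M"
    and "c (M, \<mu>, \<rho>) \<cdot> act (M, \<mu>) X \<psi> = \<mu> \<cdot> (c (M, \<mu>, \<rho>) \<rhd> A)"
    and "(c (M, \<mu>, \<rho>) \<rhd> X) \<cdot> act (M, \<mu>) (X \<odot> X) \<delta> = \<rho> \<cdot> c (M, \<mu>, \<rho>)"
  using component_hom[OF assms] by (auto simp: entwined_homs_def module_homs_def cofree_obj_eq Hom_iff)

lemma cofree_component_simps:
  assumes "(N, \<mu>) \<in> modules"
  shows "cofree_component_at N \<mu> \<in> Arr C" "Dom C (cofree_component_at N \<mu>) = N \<odot> X \<odot> X"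
    "Cod C (cofree_component_at N \<mu>) = N \<odot> X"
  using component_simps(1-3)[OF cofree_entwined[OF assms, unfolded cofree_obj_eq]] module_simps(1)[OF assms]
  by (simp_all add: cofree_obj_eq)

abbreviation "K \<equiv> cofree_component_at A m"

definition "\<beta> = K \<cdot> (\<eta> \<rhd> (X \<odot> X))"

lemma K_\<beta>_simps [simp]:
  "K \<in> Arr C" "Dom C K = A \<odot> X \<odot> X" "Cod C K = A \<odot> X"
  "\<beta> \<in> Arr C" "Dom C \<beta> = X \<odot> X" "Cod C \<beta> = A \<odot> X"
  using cofree_component_simps[OF regular_module] by (simp_all add: \<beta>_def)

text \<open>The generator property does its work here: it reduces a claim about an arbitrary object
  \<open>Y\<close> to points \<open>h\<close> from the unit object, where naturality decides
  it.\<close>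

lemma cofree_component_free:
  assumes "Y \<in> Obj C"
  shows "cofree_component_at (Y \<odot> A) (Y \<lhd> m) = Y \<lhd> K"
proof -
  note free = free_module[OF assms]
  note L = cofree_component_simps[OF free]
  have "cofree_component_at (Y \<odot> A) (Y \<lhd> m) \<cdot> (h \<rhd> (A \<odot> X \<odot> X)) = (Y \<lhd> K) \<cdot> (h \<rhd> (A \<odot> X \<odot> X))"
    if "h \<in> Hom C \<one> Y" for h
  proof -
    have h: "h \<in> Arr C" "Dom C h = \<one>" "Cod C h = Y"
      using that by (auto simp: Hom_iff)
    \<comment> \<open>As \<open>\<one> \<odot> A\<close> is \<open>A\<close>, the point
      \<open>h\<close> induces a map of free modules out of the regular one.\<close>
    have "h \<rhd> A \<in> module_homs C A (A, m) (Y \<odot> A, Y \<lhd> m)"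
      using assms h slide[of h m] by (simp add: module_homs_def Hom_iff)
    from natural[OF cofree_entwined[OF regular_module] cofree_entwined[OF free]
        cofree_hom[OF regular_module free this]]
    show ?thesis
      using assms h slide[of h K] by simp
  qed
  \<comment> \<open>The generator tests the factor \<open>Y\<close> of the source, with
    \<open>A \<odot> X \<odot> X\<close> as the inert second factor.\<close>
  then show ?thesis
    using generator L assms unfolding left_tensor_generator_def
    by (elim conjE ballE[of _ _ Y] ballE[of _ _ "A \<odot> X \<odot> X"] ballE[of _ _ "Y \<odot> A \<odot> X"]
        ballE[of _ _ "cofree_component_at (Y \<odot> A) (Y \<lhd> m)"] ballE[of _ _ "Y \<lhd> K"])
      (simp_all add: Hom_iff)
qed

text \<open>The action is a module map from the free module on \<open>N\<close>, and
  \<open>N \<lhd> \<eta>\<close> splits it in \<open>C\<close>. Hence the component at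
  \<open>N\<close> is determined by the one at the free module.\<close>

lemma cofree_component_conv_act:
  assumes "(N, \<mu>) \<in> modules"
  shows "cofree_component_at N \<mu> = act (N, \<mu>) X \<beta>"
proof -
  note N = module_simps(1-4)[OF assms] and L = cofree_component_simps[OF assms]
  note free = free_module[OF N(1)]
  have "\<mu> \<in> module_homs C A (N \<odot> A, N \<lhd> m) (N, \<mu>)"
    using N module_simps(5)[OF assms] by (simp add: module_homs_def Hom_iff)
  from natural[OF cofree_entwined[OF free] cofree_entwined[OF assms] cofree_hom[OF free assms this]]
  have nat: "cofree_component_at N \<mu> \<cdot> (\<mu> \<rhd> (X \<odot> X)) = (\<mu> \<rhd> X) \<cdot> (N \<lhd> K)"
    using N by (simp add: cofree_component_free)
  have "cofree_component_at N \<mu> = cofree_component_at N \<mu> \<cdot> ((\<mu> \<cdot> (N \<lhd> \<eta>)) \<rhd> (X \<odot> X))"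
    unfolding module_simps(6)[OF assms] using N L by simp
  also have "\<dots> = (cofree_component_at N \<mu> \<cdot> (\<mu> \<rhd> (X \<odot> X))) \<cdot> (N \<lhd> \<eta> \<rhd> (X \<odot> X))"
    using N L by simp
  also have "\<dots> = act (N, \<mu>) X \<beta>"
    unfolding nat using N by (simp add: act_eq \<beta>_def)
  finally show ?thesis .
qed

lemma casimir_of_eq: "casimir_of c = act (A, m) \<one> \<epsilon> \<cdot> \<beta>"
  by (simp add: casimir_of_def \<beta>_def act_eq)

lemma casimir_of_simps [simp]:
  "casimir_of c \<in> Arr C" "Dom C (casimir_of c) = X \<odot> X" "Cod C (casimir_of c) = A"
  by (simp_all add: casimir_of_eq)

text \<open>The coaction is an entwined map into the cofree module and has
  \<open>act (M, \<mu>) \<one> \<epsilon>\<close> as retraction in \<open>C\<close>. Hence the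
  component at \<open>M\<close> is determined by the one at the cofree module.\<close>

lemma component_conv_casimir:
  assumes "(M, \<mu>, \<rho>) \<in> entwined"
  shows "c (M, \<mu>, \<rho>) = casimir_component (casimir_of c) (M, \<mu>, \<rho>)"
proof -
  note E = entwined_simps(1-4)[OF assms] and L = component_simps(1-3)[OF assms]
  note M = module_simps(1-4)[OF E(1)]
  have nat: "act (M, \<mu>) X \<beta> \<cdot> (\<rho> \<rhd> X) = \<rho> \<cdot> c (M, \<mu>, \<rho>)"
    using natural[OF assms cofree_entwined[OF E(1)] coaction_hom[OF assms]]
    by (simp add: cofree_component_conv_act[OF E(1)])
  have "c (M, \<mu>, \<rho>) = (act (M, \<mu>) \<one> \<epsilon> \<cdot> \<rho>) \<cdot> c (M, \<mu>, \<rho>)"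
    unfolding entwined_simps(7)[OF assms] using L M by simp
  also have "\<dots> = act (M, \<mu>) \<one> \<epsilon> \<cdot> act (M, \<mu>) X \<beta> \<cdot> (\<rho> \<rhd> X)"
    unfolding nat using L M E by simp
  also have "\<dots> = (act (M, \<mu>) \<one> \<epsilon> \<cdot> act (M, \<mu>) X \<beta>) \<cdot> (\<rho> \<rhd> X)"
    using L M E by simp
  also have "\<dots> = act (M, \<mu>) \<one> (casimir_of c) \<cdot> (\<rho> \<rhd> X)"
    using M E by (simp add: act_act casimir_of_eq act_eq[of A m])
  finally show ?thesis
    by (simp add: casimir_component_def)
qed

lemma act_casimir_of:
  assumes "V \<in> Obj C"
  shows "act (A, m) V (casimir_of c \<rhd> V) = act (A, m) V (\<epsilon> \<rhd> V) \<cdot> act (A, m) (X \<odot> V) (\<beta> \<rhd> V)"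
  using assms by (simp add: act_act casimir_of_eq act_eq[of A m \<one>])

text \<open>Linearity of \<open>K\<close>, cut down along the unit, is the condition for \<beta> to
  be a transfer morphism from \<open>X \<odot> X\<close> to \<open>X\<close>.\<close>

lemma \<beta>_transfer: "act (A, m) X \<beta> \<cdot> (\<psi> \<rhd> X) \<cdot> (X \<lhd> \<psi>) = act (A, m) X \<psi> \<cdot> (\<beta> \<rhd> A)"
proof -
  have unit: "act (A, m) (X \<odot> X) ((\<psi> \<rhd> X) \<cdot> (X \<lhd> \<psi>)) \<cdot> (\<eta> \<rhd> (X \<odot> X \<odot> A)) = (\<psi> \<rhd> X) \<cdot> (X \<lhd> \<psi>)"
    by (rule regular_act_unit) simp_all
  have "act (A, m) X \<beta> \<cdot> act (A, m) (X \<odot> X) ((\<psi> \<rhd> X) \<cdot> (X \<lhd> \<psi>)) = act (A, m) X \<psi> \<cdot> (K \<rhd> A)"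
    using component_simps(4)[OF cofree_entwined[OF regular_module, unfolded cofree_obj_eq]]
    by (simp add: act_cofree cofree_obj_eq flip: cofree_component_conv_act)
  from arg_cong[OF this, of "\<lambda>z. z \<cdot> (\<eta> \<rhd> (X \<odot> X \<odot> A))"] show ?thesis
    by (simp add: unit \<beta>_def)
qed

text \<open>Colinearity of \<open>K\<close>, cut down along the unit, makes \<beta> compatible with
  the coactions that \<delta> induces on the last factor \<open>X\<close>.\<close>

lemma \<beta>_colinear: "act (A, m) (X \<odot> X) (\<beta> \<rhd> X) \<cdot> (\<psi> \<rhd> (X \<odot> X)) \<cdot> (X \<lhd> \<delta>) = act (A, m) (X \<odot> X) \<delta> \<cdot> \<beta>"
proof -
  have unit: "act (A, m) (X \<odot> X \<odot> X) ((\<psi> \<rhd> (X \<odot> X)) \<cdot> (X \<lhd> \<delta>)) \<cdot> (\<eta> \<rhd> (X \<odot> X)) = (\<psi> \<rhd> (X \<odot> X)) \<cdot> (X \<lhd> \<delta>)"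
    by (rule regular_act_unit) simp_all
  have "act (A, m) (X \<odot> X) (\<beta> \<rhd> X) \<cdot> act (A, m) (X \<odot> X \<odot> X) ((\<psi> \<rhd> (X \<odot> X)) \<cdot> (X \<lhd> \<delta>))
      = act (A, m) (X \<odot> X) \<delta> \<cdot> K"
    using component_simps(5)[OF cofree_entwined[OF regular_module, unfolded cofree_obj_eq]]
      cofree_component_conv_act[OF regular_module]
    by (simp add: act_cofree act_right_whisker cofree_obj_eq)
  from arg_cong[OF this, of "\<lambda>z. z \<cdot> (\<eta> \<rhd> (X \<odot> X))"] show ?thesis
    by (simp add: unit \<beta>_def)
qed

text \<open>The arrow is the composite of the transfer morphisms \<beta> and \<epsilon>, hence again
  one. For the Casimir condition both sides are evaluated to \<beta>.\<close>

lemma casimir_of_casimir: "casimir_of c \<in> casimir_morphisms C A m \<eta> X \<psi> \<delta>"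
proof -
  let ?B = "casimir_of c"
  have act_B: "act (A, m) \<one> ?B = act (A, m) \<one> \<epsilon> \<cdot> act (A, m) X \<beta>"
    using act_casimir_of[OF unit_closed] by simp
  have "act (A, m) \<one> ?B \<cdot> (\<psi> \<rhd> X) \<cdot> (X \<lhd> \<psi>) = act (A, m) \<one> \<epsilon> \<cdot> act (A, m) X \<beta> \<cdot> (\<psi> \<rhd> X) \<cdot> (X \<lhd> \<psi>)"
    by (simp add: act_B)
  also have "\<dots> = act (A, m) \<one> (m \<cdot> (A \<lhd> \<epsilon>) \<cdot> \<psi>) \<cdot> (\<beta> \<rhd> A)"
    using act_act[OF regular_module, of \<psi> X \<epsilon> \<one>] by (simp add: \<beta>_transfer flip: Comp_assoc_simp)
  also have "\<dots> = (m \<cdot> act (A, m) A (\<epsilon> \<rhd> A)) \<cdot> (\<beta> \<rhd> A)"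
    by (simp add: \<epsilon>_transfer action_act)
  also have "\<dots> = m \<cdot> (?B \<rhd> A)"
    by (simp add: casimir_of_eq act_right_whisker)
  finally have 1: "act (A, m) \<one> ?B \<cdot> (\<psi> \<rhd> X) \<cdot> (X \<lhd> \<psi>) = m \<cdot> (?B \<rhd> A)" .
  have cu: "act (A, m) X (\<epsilon> \<rhd> X) \<cdot> act (A, m) (X \<odot> X) \<delta> = Ide C (A \<odot> X)"
    using counit_left by (simp add: act_act act_unit)
  \<comment> \<open>Right side: colinearity of \<beta> brings \<epsilon> next to \<delta>, where the
    left counit law cancels them.\<close>
  have "act (A, m) X (?B \<rhd> X) \<cdot> (\<psi> \<rhd> (X \<odot> X)) \<cdot> (X \<lhd> \<delta>)
      = (act (A, m) X (\<epsilon> \<rhd> X) \<cdot> act (A, m) (X \<odot> X) \<delta>) \<cdot> \<beta>"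
    by (simp add: act_casimir_of \<beta>_colinear)
  also have "\<dots> = \<beta>"
    unfolding cu by simp
  \<comment> \<open>Left side: the component at \<open>A \<odot> X\<close> is rebuilt from
    \<open>?B\<close> and evaluated along the unit.\<close>
  also have "\<beta> = act (A, m) X (\<psi> \<cdot> (X \<lhd> ?B)) \<cdot> (\<delta> \<rhd> X)"
    using component_conv_casimir[OF cofree_entwined[OF regular_module, unfolded cofree_obj_eq]]
      cofree_component[of ?B] cofree_module[OF regular_module]
    by (simp add: \<beta>_def cofree_obj_eq casimir_component_def)
  finally have 2: "act (A, m) X (\<psi> \<cdot> (X \<lhd> ?B)) \<cdot> (\<delta> \<rhd> X) = act (A, m) X (?B \<rhd> X) \<cdot> (\<psi> \<rhd> (X \<odot> X)) \<cdot> (X \<lhd> \<delta>)"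
    by simp
  show ?thesis
    using 1 2 by (simp add: casimir_morphisms_def transfer_homs_def transfer_tensor_def Hom_iff act_eq)
qed

end

section \<open>The bijection\<close>

context cowreath_structure
begin

lemma cofree_transformation_casimir:
  assumes "left_tensor_generator C \<one>" "B \<in> casimir_morphisms C A m \<eta> X \<psi> \<delta>"
  shows "cofree_transformation C A m \<eta> X \<psi> \<delta> \<epsilon> (casimir_component B)"
  by unfold_locales
    (use assms casimir_component_hom casimir_component_natural in \<open>auto simp: casimir_component_def\<close>)

abbreviation "entwined_category \<equiv> entwined_cat C A m \<eta> X \<psi> \<delta> \<epsilon>"
abbreviation "transformations \<equiv> nat_trans entwined_category entwined_category (cofree C X \<psi> \<delta> \<circ>\<^sub>F forgetful) id_func"

text \<open>The object forces source and target, so a transformation carries no data beyond its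
  underlying arrows. Off the entwined modules the value is \<open>undefined\<close>, as the
  extensional families of \<open>nat_trans\<close> demand.\<close>

definition extend_components :: "('o \<times> 'a \<times> 'a \<Rightarrow> 'a) \<Rightarrow> 'o \<times> 'a \<times> 'a \<Rightarrow> ('o \<times> 'a \<times> 'a) \<times> 'a \<times> ('o \<times> 'a \<times> 'a)"
  where "extend_components c = (\<lambda>P \<in> entwined. (cofree_obj C X \<psi> \<delta> (fst P, fst (snd P)), c P, P))"

definition underlying :: "('o \<times> 'a \<times> 'a \<Rightarrow> ('o \<times> 'a \<times> 'a) \<times> 'a \<times> ('o \<times> 'a \<times> 'a)) \<Rightarrow> 'o \<times> 'a \<times> 'a \<Rightarrow> 'a"
  where "underlying \<alpha> P = fst (snd (\<alpha> P))"

lemma cofree_forgetful_entwined: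
  assumes "P \<in> entwined"
  shows "cofree_obj C X \<psi> \<delta> (fst P, fst (snd P)) \<in> entwined"
  using assms cofree_entwined entwined_simps(1) by (cases P) auto

lemma extend_components_transformation:
  assumes "cofree_transformation C A m \<eta> X \<psi> \<delta> \<epsilon> c"
  shows "extend_components c \<in> transformations"
proof -
  interpret cofree_transformation C A m \<eta> X \<psi> \<delta> \<epsilon> c
    by fact
  show ?thesis
    using component_hom natural cofree_forgetful_entwined
    by (fastforce simp: nat_trans_def extend_components_def entwined_cat_def arrows_def Hom_def comp_func_def
        cofree_def forgetful_def id_func_def)
qed

lemma transformation_conv_extend:
  assumes "\<alpha> \<in> transformations"
  shows "\<alpha> = extend_components (underlying \<alpha>)"
proof
  fix P
  show "\<alpha> P = extend_components (underlying \<alpha>) P"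
  proof (cases "P \<in> entwined")
    case True
    then have "\<alpha> P \<in> Hom entwined_category (on_obj (cofree C X \<psi> \<delta> \<circ>\<^sub>F forgetful) P) P"
      using assms by (auto simp: nat_trans_def id_func_def entwined_cat_def)
    with True show ?thesis
      by (cases P; cases "\<alpha> P") (auto simp: Hom_def entwined_cat_def comp_func_def cofree_def forgetful_def
          extend_components_def underlying_def)
  next
    case False
    then show ?thesis
      using assms by (auto simp: nat_trans_def extend_components_def entwined_cat_def intro: PiE_arb)
  qed
qed

lemma underlying_transformation:
  assumes "left_tensor_generator C \<one>" "\<alpha> \<in> transformations"
  shows "cofree_transformation C A m \<eta> X \<psi> \<delta> \<epsilon> (underlying \<alpha>)"
proof -
  have comp: "\<alpha> P \<in> Hom entwined_category (on_obj (cofree C X \<psi> \<delta> \<circ>\<^sub>F forgetful) P) P" if "P \<in> entwined" for P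
    using assms(2) that by (auto simp: nat_trans_def id_func_def entwined_cat_def)
  have ext: "\<alpha> P = (cofree_obj C X \<psi> \<delta> (fst P, fst (snd P)), underlying \<alpha> P, P)" if "P \<in> entwined" for P
    using fun_cong[OF transformation_conv_extend[OF assms(2)], of P] that by (simp add: extend_components_def)
  show ?thesis
  proof
    fix M \<mu> \<rho>
    assume "(M, \<mu>, \<rho>) \<in> entwined"
    then show "underlying \<alpha> (M, \<mu>, \<rho>) \<in> entwined_homs C A X (cofree_obj C X \<psi> \<delta> (M, \<mu>)) (M, \<mu>, \<rho>)"
      using comp[of "(M, \<mu>, \<rho>)"] ext[of "(M, \<mu>, \<rho>)"] by (auto simp: Hom_def entwined_cat_def arrows_def)
  next
    fix P Q f
    assume PQ: "P \<in> entwined" "Q \<in> entwined" "f \<in> entwined_homs C A X P Q"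
    then have "(P, f, Q) \<in> Arr entwined_category"
      by (simp add: entwined_cat_def arrows_def)
    then have "\<alpha> (Cod entwined_category (P, f, Q)) \<cdot>\<^bsub>entwined_category\<^esub> on_arr (cofree C X \<psi> \<delta> \<circ>\<^sub>F forgetful) (P, f, Q)
        = (P, f, Q) \<cdot>\<^bsub>entwined_category\<^esub> \<alpha> (Dom entwined_category (P, f, Q))"
      using assms(2) by (simp add: nat_trans_def id_func_def)
    then show "underlying \<alpha> Q \<cdot> (f \<rhd> X) = f \<cdot> underlying \<alpha> P"
      using PQ by (cases P; cases Q)
        (simp add: entwined_cat_def comp_func_def cofree_def forgetful_def id_func_def ext)
  qed (fact assms(1))
qed

text \<open>Reconstruction recovers components at entwined modules only, so equality has to be
  reduced to these.\<close>

lemma extend_components_cong: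
  assumes "\<And>P. P \<in> entwined \<Longrightarrow> c P = c' P"
  shows "extend_components c = extend_components c'"
  using assms by (auto simp: extend_components_def restrict_def)

lemma transformations_casimir_bij:
  assumes "left_tensor_generator C \<one>"
  shows "bij_betw (\<lambda>\<alpha>. casimir_of (underlying \<alpha>)) transformations (casimir_morphisms C A m \<eta> X \<psi> \<delta>)"
proof (rule bij_betwI[where g = "\<lambda>B. extend_components (casimir_component B)"])
  show "(\<lambda>\<alpha>. casimir_of (underlying \<alpha>)) \<in> transformations \<rightarrow> casimir_morphisms C A m \<eta> X \<psi> \<delta>"
    using cofree_transformation.casimir_of_casimir[OF underlying_transformation[OF assms]] by blast
  show "(\<lambda>B. extend_components (casimir_component B)) \<in> casimir_morphisms C A m \<eta> X \<psi> \<delta> \<rightarrow> transformations"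
    using extend_components_transformation cofree_transformation_casimir[OF assms] by blast
next
  fix \<alpha>
  assume \<alpha>: "\<alpha> \<in> transformations"
  interpret cofree_transformation C A m \<eta> X \<psi> \<delta> \<epsilon> "underlying \<alpha>"
    by (rule underlying_transformation[OF assms \<alpha>])
  have "extend_components (casimir_component (casimir_of (underlying \<alpha>))) = extend_components (underlying \<alpha>)"
    by (rule extend_components_cong) (auto simp: component_conv_casimir)
  then show "extend_components (casimir_component (casimir_of (underlying \<alpha>))) = \<alpha>"
    using transformation_conv_extend[OF \<alpha>] by simp
next
  fix B
  assume B: "B \<in> casimir_morphisms C A m \<eta> X \<psi> \<delta>"
  \<comment> \<open>Only the component at the cofree module over \<open>A\<close> enters
    \<open>casimir_of\<close>, and that module is entwined, so the restriction is harmless.\<close>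
  have "casimir_of (underlying (extend_components (casimir_component B))) = casimir_of (casimir_component B)"
    using cofree_entwined[OF regular_module] by (simp add: casimir_of_def underlying_def extend_components_def)
  with B show "casimir_of (underlying (extend_components (casimir_component B))) = B"
    by (simp add: casimir_of_component)
qed

end

theorem proposition4p7:
  fixes C :: "('o, 'a) moncat" and A X :: 'o and m \<eta> \<psi> \<delta> \<epsilon> :: 'a
  assumes "cowreath C A m \<eta> X \<psi> \<delta> \<epsilon>"
    and "left_tensor_generator C \<one>\<^bsub>C\<^esub>"
  shows "\<exists>\<Phi>. bij_betw \<Phi>
    (nat_trans (entwined_cat C A m \<eta> X \<psi> \<delta> \<epsilon>) (entwined_cat C A m \<eta> X \<psi> \<delta> \<epsilon>)
      (cofree C X \<psi> \<delta> \<circ>\<^sub>F forgetful) id_func)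
    (casimir_morphisms C A m \<eta> X \<psi> \<delta>)"
  using cowreath_structure.transformations_casimir_bij[OF cowreath_structureI[OF assms(1)] assms(2)]
  by blast

end
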